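(* For any connection $\nabla$ on a smooth manifold $M$, $$\hat\nabla^s\alpha_{\mathrm{can}}=g_\nabla,$$ where $\alpha_{\mathrm{can}}$ is the canonical $1$-form on $T^*M$, $\hat\nabla^s$ is the symmetric derivative corresponding to the lifted connection $\hat\nabla$ on $T^*M$, and $g_\nabla$ is the Patterson-Walker metric of $\nabla$.
   Context: $M$ is a smooth manifold of positive dimension; a connection on a manifold is an affine connection (possibly with torsion), extended to tensor fields. Let $\mathrm{pr}:T^*M\to M$ be the projection. The dual connection on $T^*M$ gives a splitting $T(T^*M)=\mathcal{H}_\nabla\oplus\mathcal{V}$ with $\mathcal{V}=\ker\mathrm{pr}_*\cong\mathrm{pr}^*T^*M$ and $\mathcal{H}_\nabla\cong\mathrm{pr}^*TM$. For $X\in\mathfrak{X}(M)$, $X^{\mathrm h}\in\Gamma(\mathcal{H}_\nabla)$ is its horizontal lift; for $\alpha\in\Omega^1(M)$, $\alpha^{\mathrm v}\in\Gamma(\mathcal{V})$ is its vertical lift (the vertical vector field constant on each fibre $T^*_mM$ with value $\alpha_m$). Writing $Y^v\in C^\infty(T^*M)$, $Y^v(\zeta)=\zeta(Y_{\mathrm{pr}(\zeta)})$, these vector fields are characterized by $X^{\mathrm h}Y^v=(\nabla_XY)^v$ and $\alpha^{\mathrm v}Y^v=\mathrm{pr}^*(\alpha(Y))$ for all $Y\in\mathfrak{X}(M)$. The Patterson-Walker metric $g_\nabla$ is the split-signature metric on the manifold $T^*M$ determined by $g_\nabla(X^{\mathrm h}+\alpha^{\mathrm v},Y^{\mathrm h}+\beta^{\mathrm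 v})=\mathrm{pr}^*(\alpha(Y)+\beta(X))$ for $X,Y\in\mathfrak{X}(M)$, $\alpha,\beta\in\Omega^1(M)$. The connection $\hat\nabla$ on the manifold $T^*M$ is uniquely determined by $\hat\nabla_{X^{\mathrm h}}Y^{\mathrm h}=(\nabla_XY)^{\mathrm h}$, $\hat\nabla_{X^{\mathrm h}}\alpha^{\mathrm v}=(\nabla_X\alpha)^{\mathrm v}$, $\hat\nabla_{\alpha^{\mathrm v}}X^{\mathrm h}=0$, $\hat\nabla_{\alpha^{\mathrm v}}\beta^{\mathrm v}=0$. The canonical $1$-form is $(\alpha_{\mathrm{can}})_\zeta(w)=\zeta(\mathrm{pr}_*w)$ for $\zeta\in T^*M$ and $w\in T_\zeta(T^*M)$. The symmetric derivative of a $1$-form $\alpha$ on a manifold with connection $D$ is $(D^s\alpha)(Q,Q')=(D_Q\alpha)(Q')+(D_{Q'}\alpha)(Q)$. *)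

theory Defs
  imports "HOL-Analysis.Analysis"
begin

section \<open>Smooth manifolds\<close>

text \<open>
  A chart is a pair \<open>(U, \<phi>)\<close>; only the values of \<open>\<phi>\<close> on \<open>U\<close> matter. A manifold is given by an
  atlas \<open>A\<close> (not necessarily maximal) with model space \<open>'e\<close>; its point set is the union of the
  chart domains, its topology the one induced by the charts, and its dimension \<open>DIM('e)\<close>, which is
  positive for every \<open>euclidean_space\<close>. Carriers are sets rather than types because the cotangent
  bundle depends on the atlas.
\<close>

type_synonym ('a, 'e) chart = "'a set \<times> ('a \<Rightarrow> 'e)"
type_synonym ('a, 'e) atlas = "('a, 'e) chart set"

text \<open>Differentiability of class \<open>C\<^sup>k\<close>; used for open \<open>S\<close> only.\<close>

fun Ck_on :: "nat \<Rightarrow> 'e::real_normed_vector set \<Rightarrow> ('e \<Rightarrow> 'f::real_normed_vector) \<Rightarrow> bool" where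
  "Ck_on 0 S f \<longleftrightarrow> continuous_on S f"
| "Ck_on (Suc k) S f \<longleftrightarrow>
     (\<forall>x\<in>S. f differentiable (at x)) \<and> (\<forall>u. Ck_on k S (\<lambda>x. frechet_derivative f (at x) u))"

definition smooth_on :: "'e::real_normed_vector set \<Rightarrow> ('e \<Rightarrow> 'f::real_normed_vector) \<Rightarrow> bool" where
  "smooth_on S f \<longleftrightarrow> (\<forall>k. Ck_on k S f)"

definition points :: "('a, 'e) atlas \<Rightarrow> 'a set" where
  "points A = (\<Union>(U, \<phi>)\<in>A. U)"

definition atlas_topology :: "('a, 'e::euclidean_space) atlas \<Rightarrow> 'a topology" where
  "atlas_topology A = topology_generated_by {U \<inter> \<phi> -` V | U \<phi> V. (U, \<phi>) \<in> A \<and> open V}"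

definition smooth_manifold :: "('a, 'e::euclidean_space) atlas \<Rightarrow> bool" where
  "smooth_manifold A \<longleftrightarrow>
     (\<forall>(U, \<phi>)\<in>A. inj_on \<phi> U \<and> open (\<phi> ` U)) \<and>
     (\<forall>(U, \<phi>)\<in>A. \<forall>(V, \<psi>)\<in>A. open (\<phi> ` (U \<inter> V)) \<and>
        smooth_on (\<phi> ` (U \<inter> V)) (\<psi> \<circ> inv_into U \<phi>)) \<and>
     Hausdorff_space (atlas_topology A) \<and> second_countable (atlas_topology A)"

text \<open>\<open>C\<^sup>\<infinity>(M)\<close>. Values outside \<open>points A\<close> are arbitrary; tangent vectors below do not see them.\<close>

definition smooth_funs :: "('a, 'e::euclidean_space) atlas \<Rightarrow> ('a \<Rightarrow> real) set" where
  "smooth_funs A = {f. \<forall>(U, \<phi>)\<in>A. smooth_on (\<phi> ` U) (f \<circ> inv_into U \<phi>)}"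


section \<open>Tangent and cotangent vectors\<close>

text \<open>
  Tangent vectors are the directional derivative operators \<open>C\<^sup>\<infinity>(M) \<rightarrow> \<real>\<close>, and cotangent vectors the
  linear functionals on the tangent space. Operators on smooth functions, functionals on a tangent
  space and tensor fields are all extended by \<open>0\<close>, so that equality of them is equality in HOL.
  Linear combinations are formed pointwise.
\<close>

type_synonym 'a tvec = "('a \<Rightarrow> real) \<Rightarrow> real"
type_synonym 'a cvec = "'a tvec \<Rightarrow> real"

definition coord_vec :: "('a, 'e::euclidean_space) atlas \<Rightarrow> ('a, 'e) chart \<Rightarrow> 'a \<Rightarrow> 'e \<Rightarrow> 'a tvec" where
  "coord_vec A = (\<lambda>(U, \<phi>) m u f. if f \<in> smooth_funs A
     then frechet_derivative (f \<circ> inv_into U \<phi>) (at (\<phi> m)) u else 0)"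

definition tangent_space :: "('a, 'e::euclidean_space) atlas \<Rightarrow> 'a \<Rightarrow> 'a tvec set" where
  "tangent_space A m = {coord_vec A (U, \<phi>) m u | U \<phi> u. (U, \<phi>) \<in> A \<and> m \<in> U}"

definition cotangent_space :: "('a, 'e::euclidean_space) atlas \<Rightarrow> 'a \<Rightarrow> 'a cvec set" where
  "cotangent_space A m = {\<zeta>.
     (\<forall>v\<in>tangent_space A m. \<forall>w\<in>tangent_space A m. \<forall>a b.
        \<zeta> (\<lambda>f. a * v f + b * w f) = a * \<zeta> v + b * \<zeta> w) \<and>
     (\<forall>v. v \<notin> tangent_space A m \<longrightarrow> \<zeta> v = 0)}"

text \<open>The differential of a smooth map \<open>F\<close> into the manifold \<open>B\<close>, applied to \<open>w\<close>.\<close>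

definition pushforward :: "('b, 'e::euclidean_space) atlas \<Rightarrow> ('a \<Rightarrow> 'b) \<Rightarrow> 'a tvec \<Rightarrow> 'b tvec" where
  "pushforward B F w = (\<lambda>f. if f \<in> smooth_funs B then w (f \<circ> F) else 0)"


section \<open>Vector fields, 1-forms, connections\<close>

type_synonym 'a vfield = "'a \<Rightarrow> 'a tvec"
type_synonym 'a form1 = "'a \<Rightarrow> 'a cvec"

definition vfields :: "('a, 'e::euclidean_space) atlas \<Rightarrow> 'a vfield set" where
  "vfields A = {X. (\<forall>m\<in>points A. X m \<in> tangent_space A m) \<and>
     (\<forall>m. m \<notin> points A \<longrightarrow> X m = (\<lambda>_. 0)) \<and>
     (\<forall>f\<in>smooth_funs A. (\<lambda>m. X m f) \<in> smooth_funs A)}"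

definition forms1 :: "('a, 'e::euclidean_space) atlas \<Rightarrow> 'a form1 set" where
  "forms1 A = {\<alpha>. (\<forall>m\<in>points A. \<alpha> m \<in> cotangent_space A m) \<and>
     (\<forall>m. m \<notin> points A \<longrightarrow> \<alpha> m = (\<lambda>_. 0)) \<and>
     (\<forall>Y\<in>vfields A. (\<lambda>m. \<alpha> m (Y m)) \<in> smooth_funs A)}"

definition vf_add :: "'a vfield \<Rightarrow> 'a vfield \<Rightarrow> 'a vfield" where
  "vf_add X Y = (\<lambda>m f. X m f + Y m f)"

definition vf_scale :: "('a \<Rightarrow> real) \<Rightarrow> 'a vfield \<Rightarrow> 'a vfield" where
  "vf_scale h X = (\<lambda>m f. h m * X m f)"

definition vf_zero :: "'a vfield" where
  "vf_zero = (\<lambda>m f. 0)"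

definition connection ::
    "('a, 'e::euclidean_space) atlas \<Rightarrow> ('a vfield \<Rightarrow> 'a vfield \<Rightarrow> 'a vfield) \<Rightarrow> bool" where
  "connection A nab \<longleftrightarrow>
     (\<forall>X\<in>vfields A. \<forall>Y\<in>vfields A. nab X Y \<in> vfields A) \<and>
     (\<forall>X\<in>vfields A. \<forall>X'\<in>vfields A. \<forall>Y\<in>vfields A.
        nab (vf_add X X') Y = vf_add (nab X Y) (nab X' Y)) \<and>
     (\<forall>X\<in>vfields A. \<forall>Y\<in>vfields A. \<forall>Y'\<in>vfields A.
        nab X (vf_add Y Y') = vf_add (nab X Y) (nab X Y')) \<and>
     (\<forall>h\<in>smooth_funs A. \<forall>X\<in>vfields A. \<forall>Y\<in>vfields A.
        nab (vf_scale h X) Y = vf_scale h (nab X Y) \<and>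
        nab X (vf_scale h Y) = vf_add (vf_scale (\<lambda>m. X m h) Y) (vf_scale h (nab X Y)))"

text \<open>The dual connection: \<open>(\<nabla>\<^sub>X \<alpha>)(Y) = X(\<alpha>(Y)) - \<alpha>(\<nabla>\<^sub>X Y)\<close>.\<close>

definition nabla_form ::
    "('a, 'e::euclidean_space) atlas \<Rightarrow> ('a vfield \<Rightarrow> 'a vfield \<Rightarrow> 'a vfield) \<Rightarrow>
     'a vfield \<Rightarrow> 'a form1 \<Rightarrow> 'a form1" where
  "nabla_form A nab X \<alpha> = (THE \<beta>. \<beta> \<in> forms1 A \<and>
     (\<forall>Y\<in>vfields A. \<forall>m\<in>points A. \<beta> m (Y m) = X m (\<lambda>p. \<alpha> p (Y p)) - \<alpha> m (nab X Y m)))"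

definition sym_deriv ::
    "('a, 'e::euclidean_space) atlas \<Rightarrow> ('a vfield \<Rightarrow> 'a vfield \<Rightarrow> 'a vfield) \<Rightarrow>
     'a form1 \<Rightarrow> 'a vfield \<Rightarrow> 'a vfield \<Rightarrow> 'a \<Rightarrow> real" where
  "sym_deriv A nab \<alpha> Q Q' =
     (\<lambda>m. nabla_form A nab Q \<alpha> m (Q' m) + nabla_form A nab Q' \<alpha> m (Q m))"

text \<open>
  A pseudo-Riemannian metric of split signature: a smooth symmetric bilinear form on the tangent
  spaces with, at each point, an orthonormal basis with as many negative as positive vectors.
  Orthonormality and \<open>2 * k = DIM('e)\<close> make \<open>e\<close> a basis, so nondegeneracy is implied.
\<close>

definition split_metric ::
    "('a, 'e::euclidean_space) atlas \<Rightarrow> ('a \<Rightarrow> 'a tvec \<Rightarrow> 'a tvec \<Rightarrow> real) \<Rightarrow> bool" where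
  "split_metric A g \<longleftrightarrow>
     (\<forall>m\<in>points A.
        (\<forall>v\<in>tangent_space A m. \<forall>w\<in>tangent_space A m. g m v w = g m w v) \<and>
        (\<forall>v\<in>tangent_space A m. \<forall>v'\<in>tangent_space A m. \<forall>w\<in>tangent_space A m. \<forall>a b.
           g m (\<lambda>f. a * v f + b * v' f) w = a * g m v w + b * g m v' w) \<and>
        (\<exists>k e. 2 * k = DIM('e) \<and> (\<forall>i<2*k. e i \<in> tangent_space A m) \<and>
           (\<forall>i<2*k. \<forall>j<2*k. g m (e i) (e j) =
              (if i \<noteq> j then 0 else if i < k then 1 else -1)))) \<and>
     (\<forall>X\<in>vfields A. \<forall>Y\<in>vfields A. (\<lambda>m. g m (X m) (Y m)) \<in> smooth_funs A)"


section \<open>The cotangent bundle\<close>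

type_synonym 'a cpoint = "'a \<times> 'a cvec"

text \<open>
  Points are pairs \<open>(m, \<zeta>)\<close> with \<open>\<zeta>\<close> a cotangent vector at \<open>m\<close>, so that \<open>pr = fst\<close>. Each chart
  \<open>(x\<^sup>i)\<close> of \<open>M\<close> induces the chart \<open>(x\<^sup>i, p\<^sub>i)\<close> with \<open>p\<^sub>i(\<zeta>) = \<zeta>(\<partial>/\<partial>x\<^sup>i)\<close>.
\<close>

definition cot_chart ::
    "('a, 'e::euclidean_space) atlas \<Rightarrow> ('a, 'e) chart \<Rightarrow> ('a cpoint, 'e \<times> 'e) chart" where
  "cot_chart A = (\<lambda>(U, \<phi>).
     ({(m, \<zeta>). m \<in> U \<and> \<zeta> \<in> cotangent_space A m},
      \<lambda>(m, \<zeta>). (\<phi> m, \<Sum>b\<in>Basis. \<zeta> (coord_vec A (U, \<phi>) m b) *\<^sub>R b)))"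

definition cotangent_bundle ::
    "('a, 'e::euclidean_space) atlas \<Rightarrow> ('a cpoint, 'e \<times> 'e) atlas" where
  "cotangent_bundle A = cot_chart A ` A"

definition canonical_form :: "('a, 'e::euclidean_space) atlas \<Rightarrow> 'a cpoint form1" where
  "canonical_form A = (\<lambda>z w.
     if z \<in> points (cotangent_bundle A) \<and> w \<in> tangent_space (cotangent_bundle A) z
     then snd z (pushforward A fst w) else 0)"

text \<open>
  The identification of the vertical space at \<open>z = (m, \<zeta>)\<close> with the cotangent space at \<open>m\<close>:
  \<open>\<eta>\<close> corresponds to the velocity at \<open>t = 0\<close> of the curve \<open>t \<mapsto> (m, \<zeta> + t \<eta>)\<close>.
\<close>

definition vertical_vec ::
    "('a, 'e::euclidean_space) atlas \<Rightarrow> 'a cpoint \<Rightarrow> 'a cvec \<Rightarrow> 'a cpoint tvec" where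
  "vertical_vec A z \<eta> = (\<lambda>f. if f \<in> smooth_funs (cotangent_bundle A)
     then deriv (\<lambda>t. f (fst z, \<lambda>v. snd z v + t * \<eta> v)) 0 else 0)"

definition vlift :: "('a, 'e::euclidean_space) atlas \<Rightarrow> 'a form1 \<Rightarrow> 'a cpoint vfield" where
  "vlift A \<alpha> = (\<lambda>z. if z \<in> points (cotangent_bundle A) then vertical_vec A z (\<alpha> (fst z))
     else (\<lambda>_. 0))"

text \<open>
  The horizontal space of the dual connection at \<open>z = (m, \<zeta>)\<close>: for sections \<open>\<sigma>\<close> of \<open>T\<^sup>*M\<close> with
  \<open>\<sigma>\<^sub>m = \<zeta>\<close>, the vertical component of \<open>\<sigma>\<^sub>* X\<^sub>m\<close> is \<open>(\<nabla>\<^sub>X \<sigma>)\<^sub>m\<close>, and what remains is horizontal.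
\<close>

definition horizontal_space ::
    "('a, 'e::euclidean_space) atlas \<Rightarrow> ('a vfield \<Rightarrow> 'a vfield \<Rightarrow> 'a vfield) \<Rightarrow>
     'a cpoint \<Rightarrow> 'a cpoint tvec set" where
  "horizontal_space A nab z =
     {(\<lambda>f. pushforward (cotangent_bundle A) (\<lambda>p. (p, \<sigma> p)) (X (fst z)) f
           - vertical_vec A z (nabla_form A nab X \<sigma> (fst z)) f) | X \<sigma>.
        X \<in> vfields A \<and> \<sigma> \<in> forms1 A \<and> \<sigma> (fst z) = snd z}"

definition hlift ::
    "('a, 'e::euclidean_space) atlas \<Rightarrow> ('a vfield \<Rightarrow> 'a vfield \<Rightarrow> 'a vfield) \<Rightarrow>
     'a vfield \<Rightarrow> 'a cpoint vfield" where
  "hlift A nab X = (\<lambda>z. if z \<in> points (cotangent_bundle A)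
     then (THE w. w \<in> horizontal_space A nab z \<and> pushforward A fst w = X (fst z))
     else (\<lambda>_. 0))"

definition lifted_connection ::
    "('a, 'e::euclidean_space) atlas \<Rightarrow> ('a vfield \<Rightarrow> 'a vfield \<Rightarrow> 'a vfield) \<Rightarrow>
     ('a cpoint vfield \<Rightarrow> 'a cpoint vfield \<Rightarrow> 'a cpoint vfield) \<Rightarrow> bool" where
  "lifted_connection A nab D \<longleftrightarrow>
     connection (cotangent_bundle A) D \<and>
     (\<forall>X\<in>vfields A. \<forall>Y\<in>vfields A. D (hlift A nab X) (hlift A nab Y) = hlift A nab (nab X Y)) \<and>
     (\<forall>X\<in>vfields A. \<forall>\<alpha>\<in>forms1 A.
        D (hlift A nab X) (vlift A \<alpha>) = vlift A (nabla_form A nab X \<alpha>) \<and>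
        D (vlift A \<alpha>) (hlift A nab X) = vf_zero) \<and>
     (\<forall>\<alpha>\<in>forms1 A. \<forall>\<beta>\<in>forms1 A. D (vlift A \<alpha>) (vlift A \<beta>) = vf_zero)"

definition patterson_walker ::
    "('a, 'e::euclidean_space) atlas \<Rightarrow> ('a vfield \<Rightarrow> 'a vfield \<Rightarrow> 'a vfield) \<Rightarrow>
     ('a cpoint \<Rightarrow> 'a cpoint tvec \<Rightarrow> 'a cpoint tvec \<Rightarrow> real) \<Rightarrow> bool" where
  "patterson_walker A nab g \<longleftrightarrow>
     split_metric (cotangent_bundle A) g \<and>
     (\<forall>X\<in>vfields A. \<forall>Y\<in>vfields A. \<forall>\<alpha>\<in>forms1 A. \<forall>\<beta>\<in>forms1 A.
        \<forall>z\<in>points (cotangent_bundle A).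
          g z (vf_add (hlift A nab X) (vlift A \<alpha>) z) (vf_add (hlift A nab Y) (vlift A \<beta>) z)
            = \<alpha> (fst z) (Y (fst z)) + \<beta> (fst z) (X (fst z)))"

end

theory Submission
  imports Defs "HOL-Computational_Algebra.Polynomial"
begin

text \<open>
  Both sides of the identity are tensorial in the two vector fields on \<open>T\<^sup>*M\<close>, and at each point
  \<open>z = (m, \<zeta>)\<close> every tangent vector is the value of some \<open>X\<^sup>h + \<alpha>\<^sup>v\<close> with \<open>X\<close> and \<open>\<alpha>\<close> defined on all
  of \<open>M\<close> (\<open>tangent_decomposition\<close>). So it suffices to treat \<open>P = X\<^sup>h + \<alpha>\<^sup>v\<close> and \<open>Q = Y\<^sup>h + \<beta>\<^sup>v\<close>. Write
  \<open>Y\<^sup>v\<close> for the function \<open>(m, \<zeta>) \<mapsto> \<zeta>(Y\<^sub>m)\<close>, called \<open>lin_fun Y\<close> below. The canonical form sends \<open>Y\<^sup>h\<close> to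
  \<open>Y\<^sup>v\<close> and kills vertical lifts, hence its value on \<open>Q\<close> is \<open>Y\<^sup>v\<close>; the lifts act by
  \<open>X\<^sup>h Y\<^sup>v = (\<nabla>\<^sub>X Y)\<^sup>v\<close> and \<open>\<alpha>\<^sup>v Y\<^sup>v = \<alpha>(Y)\<close>; and the horizontal part of the lifted derivative of \<open>Q\<close>
  along \<open>P\<close> is \<open>(\<nabla>\<^sub>X Y)\<^sup>h\<close>. The derivative of the canonical form along \<open>P\<close>, evaluated on \<open>Q\<close>, is
  therefore \<open>(\<nabla>\<^sub>X Y)\<^sup>v + \<alpha>(Y) - (\<nabla>\<^sub>X Y)\<^sup>v = \<alpha>(Y)\<close> (\<open>lifted_derivative_canonical_form\<close>). Exchanging
  the roles of \<open>P\<close> and \<open>Q\<close> gives \<open>\<beta>(X)\<close>, and \<open>\<alpha>(Y) + \<beta>(X)\<close> is the Patterson-Walker metric.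

  Most of the work lies in making sense of the ingredients. The derivative of a 1-form and the
  horizontal lift are definite descriptions, so their existence and uniqueness have to be proved;
  this rests on tensoriality (\<open>tensorial_pointwise\<close>, \<open>form_of_tensor\<close>), hence on frames that are
  defined near a point and cut off to global fields. These arguments are needed on \<open>M\<close> and on
  \<open>T\<^sup>*M\<close>. They are carried out once, for an atlas that has smooth transition maps and enough bump
  functions (locale \<open>bump_atlas\<close>). A smooth manifold is such an atlas by the Hausdorff property
  (\<open>smooth_manifold_bump_atlas\<close>), and \<open>T\<^sup>*M\<close> inherits the property by pulling bump functions back
  along the projection (\<open>cotangent_bundle_bump_atlas\<close>).
\<close>

section \<open>Smooth maps between Euclidean open sets\<close>

lemma frechet_derivative_cong_open:
  assumes "open S" "x \<in> S" "\<And>y. y \<in> S \<Longrightarrow> f y = g y"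
  shows "frechet_derivative f (at x) = frechet_derivative g (at x)"
proof -
  have "(f has_derivative D) (at x) \<longleftrightarrow> (g has_derivative D) (at x)" for D
    using assms has_derivative_transform_within_open[of f D x UNIV S g]
      has_derivative_transform_within_open[of g D x UNIV S f] by auto
  then show ?thesis by (simp add: frechet_derivative_def)
qed

lemma differentiable_cong_open:
  assumes "open S" "x \<in> S" "\<And>y. y \<in> S \<Longrightarrow> f y = g y" "f differentiable (at x)"
  shows "g differentiable (at x)"
  using assms has_derivative_transform_within_open[of f _ x UNIV S g]
  unfolding differentiable_def by metis

lemma Ck_on_cong:
  assumes "open S" "\<And>y. y \<in> S \<Longrightarrow> f y = g y" "Ck_on k S f"
  shows "Ck_on k S g"
  using assms(2,3)
proof (induction k arbitrary: f g)
  case 0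
  then show ?case using continuous_on_cong[OF refl, of S f g] by simp
next
  case (Suc k)
  have "Ck_on k S (\<lambda>x. frechet_derivative g (at x) u)" for u
    by (rule Suc.IH[of "\<lambda>x. frechet_derivative f (at x) u"])
      (use frechet_derivative_cong_open[OF assms(1) _ Suc.prems(1)] Suc.prems(2) in auto)
  moreover have "g differentiable (at x)" if "x \<in> S" for x
    using differentiable_cong_open[OF assms(1) that Suc.prems(1)] Suc.prems(2) that by simp
  ultimately show ?case by simp
qed

lemma Ck_on_subset: "Ck_on k S f \<Longrightarrow> T \<subseteq> S \<Longrightarrow> Ck_on k T f"
  by (induction k arbitrary: f) (auto intro: continuous_on_subset)

lemma Ck_on_local:
  assumes "open S" "\<And>x. x \<in> S \<Longrightarrow> \<exists>T. open T \<and> x \<in> T \<and> Ck_on k T f"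
  shows "Ck_on k S f"
  using assms(2)
proof (induction k arbitrary: f)
  case 0
  have "isCont f x" if "x \<in> S" for x
    using 0[OF that] continuous_on_eq_continuous_at by auto
  then show ?case by (simp add: continuous_at_imp_continuous_on)
next
  case (Suc k)
  have "Ck_on k S (\<lambda>x. frechet_derivative f (at x) u)" for u
  proof (rule Suc.IH)
    fix x assume "x \<in> S"
    then obtain T where "open T" "x \<in> T" "Ck_on (Suc k) T f" using Suc.prems by blast
    then show "\<exists>T. open T \<and> x \<in> T \<and> Ck_on k T (\<lambda>x. frechet_derivative f (at x) u)" by auto
  qed
  moreover have "f differentiable (at x)" if "x \<in> S" for x
    using Suc.prems[OF that] by auto
  ultimately show ?case by simp
qed

lemma Ck_on_SucD: "Ck_on (Suc k) S f \<Longrightarrow> Ck_on k S f"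
proof (induction k arbitrary: f)
  case 0
  then show ?case
    by (auto intro!: continuous_at_imp_continuous_on differentiable_imp_continuous_within)
next
  case (Suc k)
  have "Ck_on k S (\<lambda>x. frechet_derivative f (at x) u)" for u
    by (rule Suc.IH) (use Suc.prems in simp)
  with Suc.prems show ?case by simp
qed

lemma Ck_on_SucI:
  assumes "open S" "\<And>x. x \<in> S \<Longrightarrow> (f has_derivative f' x) (at x)" "\<And>u. Ck_on k S (\<lambda>x. f' x u)"
  shows "Ck_on (Suc k) S f"
proof -
  have "frechet_derivative f (at x) u = f' x u" if "x \<in> S" for x u
    using frechet_derivative_at[OF assms(2)[OF that]] by simp
  then have "Ck_on k S (\<lambda>x. frechet_derivative f (at x) u)" for u
    by (rule_tac Ck_on_cong[OF assms(1) _ assms(3)[of u]]) simp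
  then show ?thesis using assms(2) by (auto simp: differentiable_def)
qed

lemma Ck_on_SucD2:
  assumes "Ck_on (Suc k) S f"
  shows "x \<in> S \<Longrightarrow> (f has_derivative frechet_derivative f (at x)) (at x)"
    "Ck_on k S (\<lambda>x. frechet_derivative f (at x) u)"
  using assms frechet_derivative_works[of f "at x"] by auto

lemma Ck_on_const: "Ck_on k S (\<lambda>x. c)"
proof (induction k arbitrary: c)
  case (Suc k)
  have "frechet_derivative (\<lambda>x. c) (at x) = (\<lambda>_. 0)" for x
    by (rule frechet_derivative_at[symmetric]) simp
  with Suc show ?case by simp
qed simp

lemma Ck_on_linear:
  assumes "bounded_linear L" "open S" "Ck_on k S f"
  shows "Ck_on k S (\<lambda>x. L (f x))"
  using assms(3)
proof (induction k arbitrary: f)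
  case 0
  then show ?case using bounded_linear.continuous_on[OF assms(1)] by auto
next
  case (Suc k)
  show ?case
    by (rule Ck_on_SucI[OF assms(2) bounded_linear.has_derivative[OF assms(1) Ck_on_SucD2(1)[OF Suc.prems]]])
      (simp_all add: Suc.IH[OF Ck_on_SucD2(2)[OF Suc.prems]])
qed

lemma Ck_on_ident: "open S \<Longrightarrow> Ck_on k S (\<lambda>x. x)"
proof (cases k)
  case (Suc j)
  assume "open S"
  then show ?thesis unfolding Suc
    by (rule Ck_on_SucI[where f' = "\<lambda>_ u. u"]) (simp_all add: Ck_on_const)
qed simp

lemma Ck_on_add:
  assumes "open S" "Ck_on k S f" "Ck_on k S g"
  shows "Ck_on k S (\<lambda>x. f x + g x)"
  using assms(2,3)
proof (induction k arbitrary: f g)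
  case 0
  then show ?case by (simp add: continuous_on_add)
next
  case (Suc k)
  show ?case
    by (rule Ck_on_SucI[OF assms(1) has_derivative_add[OF Ck_on_SucD2(1)[OF Suc.prems(1)]
           Ck_on_SucD2(1)[OF Suc.prems(2)]]])
      (simp_all add: Suc.IH[OF Ck_on_SucD2(2)[OF Suc.prems(1)] Ck_on_SucD2(2)[OF Suc.prems(2)]])
qed

lemma Ck_on_sum:
  assumes "open S" "\<And>i. i \<in> I \<Longrightarrow> Ck_on k S (f i)"
  shows "Ck_on k S (\<lambda>x. \<Sum>i\<in>I. f i x)"
  using assms(2)
  by (induction I rule: infinite_finite_induct) (simp_all add: Ck_on_const Ck_on_add[OF assms(1)])

lemma Ck_on_bilinear:
  assumes "bounded_bilinear pr" "open S" "Ck_on k S f" "Ck_on k S g"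
  shows "Ck_on k S (\<lambda>x. pr (f x) (g x))"
  using assms(3,4)
proof (induction k arbitrary: f g)
  case 0
  then show ?case using bounded_bilinear.continuous_on[OF assms(1)] by auto
next
  case (Suc k)
  show ?case
  proof (rule Ck_on_SucI[OF assms(2) bounded_bilinear.FDERIV[OF assms(1)
        Ck_on_SucD2(1)[OF Suc.prems(1)] Ck_on_SucD2(1)[OF Suc.prems(2)]]])
    show "Ck_on k S (\<lambda>x. pr (f x) (frechet_derivative g (at x) u)
        + pr (frechet_derivative f (at x) u) (g x))" for u
      by (rule Ck_on_add[OF assms(2)
        Suc.IH[OF Ck_on_SucD[OF Suc.prems(1)] Ck_on_SucD2(2)[OF Suc.prems(2)]]
        Suc.IH[OF Ck_on_SucD2(2)[OF Suc.prems(1)] Ck_on_SucD[OF Suc.prems(2)]]])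
  qed simp_all
qed

text \<open>
  The derivative of \<open>g \<circ> f\<close> in direction \<open>u\<close> is expanded in the basis of the middle space, because
  \<open>Ck_on\<close> controls the derivative of \<open>g\<close> only in directions that do not depend on the point.
\<close>

lemma Ck_on_compose:
  fixes f :: "'e::real_normed_vector \<Rightarrow> 'f::euclidean_space" and g :: "'f \<Rightarrow> 'g::real_normed_vector"
  assumes "open S" "open T" "f ` S \<subseteq> T" "Ck_on k S f" "Ck_on k T g"
  shows "Ck_on k S (g \<circ> f)"
  using assms(4,5)
proof (induction k arbitrary: g)
  case 0
  then show ?case using assms(3)
    by (metis Ck_on.simps(1) continuous_on_compose continuous_on_subset)
next
  case (Suc k)
  note Df = Ck_on_SucD2[OF Suc.prems(1)] and Dg = Ck_on_SucD2[OF Suc.prems(2)]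
  have fT: "f x \<in> T" if "x \<in> S" for x using assms(3) that by auto
  show ?case
  proof (rule Ck_on_SucI[OF assms(1)])
    show "(g \<circ> f has_derivative frechet_derivative g (at (f x)) \<circ> frechet_derivative f (at x)) (at x)"
      if "x \<in> S" for x
      using diff_chain_at Df(1) Dg(1) fT that by blast
    fix u
    have eq: "(\<Sum>b\<in>Basis. (frechet_derivative f (at x) u \<bullet> b) *\<^sub>R
        ((\<lambda>y. frechet_derivative g (at y) b) \<circ> f) x)
      = (frechet_derivative g (at (f x)) \<circ> frechet_derivative f (at x)) u" if "x \<in> S" for x
    proof -
      interpret G: linear "frechet_derivative g (at (f x))"
        using Dg(1)[OF fT[OF that]] by (rule has_derivative_linear)
      show ?thesis
        by (simp add: G.sum[symmetric] G.scale[symmetric] euclidean_representation)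
    qed
    show "Ck_on k S (\<lambda>x. (frechet_derivative g (at (f x)) \<circ> frechet_derivative f (at x)) u)"
      by (rule Ck_on_cong[OF assms(1) eq], assumption)
        (intro Ck_on_sum[OF assms(1)] Ck_on_bilinear[OF bounded_bilinear_scaleR assms(1)]
          Ck_on_linear[OF bounded_linear_inner_left assms(1) Df(2)]
          Suc.IH[OF Ck_on_SucD[OF Suc.prems(1)] Dg(2)])
  qed
qed

lemma Ck_on_inverse:
  "Ck_on k (- {0}) (inverse :: real \<Rightarrow> real)"
proof (induction k)
  case 0
  then show ?case by (auto intro!: continuous_intros)
next
  case (Suc k)
  show ?case
  proof (rule Ck_on_SucI[where f' = "\<lambda>x u. - (inverse x * u * inverse x)"])
    show "(inverse has_derivative (\<lambda>u. - (inverse x * u * inverse x))) (at x)"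
      if "x \<in> - {0}" for x :: real
      using that by (auto intro: has_derivative_inverse')
    show "Ck_on k (- {0}) (\<lambda>x::real. - (inverse x * u * inverse x))" for u
      by (intro Ck_on_linear[OF bounded_linear_minus[OF bounded_linear_ident]]
        Ck_on_bilinear[OF bounded_bilinear_mult] Suc Ck_on_const) auto
  qed auto
qed

lemma smooth_on_cong: "open S \<Longrightarrow> (\<And>y. y \<in> S \<Longrightarrow> f y = g y) \<Longrightarrow> smooth_on S f \<Longrightarrow> smooth_on S g"
  unfolding smooth_on_def using Ck_on_cong[of S f g] by blast

lemma smooth_on_subset: "smooth_on S f \<Longrightarrow> T \<subseteq> S \<Longrightarrow> smooth_on T f"
  unfolding smooth_on_def using Ck_on_subset by blast

lemma smooth_on_local:
  assumes "open S" "\<And>x. x \<in> S \<Longrightarrow> \<exists>T. open T \<and> x \<in> T \<and> smooth_on T f"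
  shows "smooth_on S f"
  unfolding smooth_on_def
proof
  show "Ck_on k S f" for k
    by (rule Ck_on_local[OF assms(1)]) (use assms(2) in \<open>auto simp: smooth_on_def\<close>)
qed

lemma smooth_on_const: "smooth_on S (\<lambda>x. c)"
  by (simp add: smooth_on_def Ck_on_const)

lemma smooth_on_ident: "open S \<Longrightarrow> smooth_on S (\<lambda>x. x)"
  by (simp add: smooth_on_def Ck_on_ident)

lemma smooth_on_linear: "bounded_linear L \<Longrightarrow> open S \<Longrightarrow> smooth_on S f \<Longrightarrow> smooth_on S (\<lambda>x. L (f x))"
  by (simp add: smooth_on_def Ck_on_linear)

lemma smooth_on_add: "open S \<Longrightarrow> smooth_on S f \<Longrightarrow> smooth_on S g \<Longrightarrow> smooth_on S (\<lambda>x. f x + g x)"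
  by (simp add: smooth_on_def Ck_on_add)

lemma smooth_on_sum:
  "open S \<Longrightarrow> (\<And>i. i \<in> I \<Longrightarrow> smooth_on S (f i)) \<Longrightarrow> smooth_on S (\<lambda>x. \<Sum>i\<in>I. f i x)"
  by (simp add: smooth_on_def Ck_on_sum)

lemma smooth_on_bilinear:
  "bounded_bilinear pr \<Longrightarrow> open S \<Longrightarrow> smooth_on S f \<Longrightarrow> smooth_on S g \<Longrightarrow>
    smooth_on S (\<lambda>x. pr (f x) (g x))"
  by (simp add: smooth_on_def Ck_on_bilinear)

lemmas smooth_on_mult = smooth_on_bilinear[OF bounded_bilinear_mult]
  and smooth_on_scaleR = smooth_on_bilinear[OF bounded_bilinear_scaleR]
  and smooth_on_inner = smooth_on_bilinear[OF bounded_bilinear_inner]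

lemma smooth_on_compose:
  fixes f :: "'e::real_normed_vector \<Rightarrow> 'f::euclidean_space" and g :: "'f \<Rightarrow> 'g::real_normed_vector"
  shows "open S \<Longrightarrow> open T \<Longrightarrow> f ` S \<subseteq> T \<Longrightarrow> smooth_on S f \<Longrightarrow> smooth_on T g \<Longrightarrow> smooth_on S (g \<circ> f)"
  by (simp add: smooth_on_def Ck_on_compose)

lemma smooth_on_has_derivative:
  "smooth_on S f \<Longrightarrow> x \<in> S \<Longrightarrow> (f has_derivative frechet_derivative f (at x)) (at x)"
  unfolding smooth_on_def using Ck_on_SucD2(1) by blast

lemma smooth_on_frechet_derivative:
  "smooth_on S f \<Longrightarrow> smooth_on S (\<lambda>x. frechet_derivative f (at x) u)"
  unfolding smooth_on_def using Ck_on_SucD2(2) by blast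

lemma smooth_on_Pair:
  assumes "open S" "smooth_on S f" "smooth_on S g"
  shows "smooth_on S (\<lambda>x. (f x, g x))"
proof -
  have 1: "bounded_linear (\<lambda>a. (a, 0))" and 2: "bounded_linear (\<lambda>a. (0, a))"
    by (auto intro: bounded_linear_Pair bounded_linear_ident bounded_linear_zero)
  have "smooth_on S (\<lambda>x. (f x, 0) + (0, g x))"
    by (intro smooth_on_add smooth_on_linear[OF 1] smooth_on_linear[OF 2] assms)
  then show ?thesis by simp
qed

lemma smooth_on_components:
  fixes f :: "'e::real_normed_vector \<Rightarrow> 'f::euclidean_space"
  assumes "open S" "\<And>b. b \<in> Basis \<Longrightarrow> smooth_on S (\<lambda>x. f x \<bullet> b)"
  shows "smooth_on S f"
proof -
  have "smooth_on S (\<lambda>x. \<Sum>b\<in>Basis. (f x \<bullet> b) *\<^sub>R b)"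
    by (intro smooth_on_sum assms smooth_on_scaleR smooth_on_const)
  then show ?thesis by (simp add: euclidean_representation)
qed

lemma frechet_derivative_in_basis:
  fixes f :: "'e::euclidean_space \<Rightarrow> 'f::real_normed_vector"
  assumes "f differentiable (at x)"
  shows "frechet_derivative f (at x) u = (\<Sum>b\<in>Basis. (u \<bullet> b) *\<^sub>R frechet_derivative f (at x) b)"
proof -
  interpret L: linear "frechet_derivative f (at x)"
    using assms by (rule linear_frechet_derivative)
  show ?thesis
    by (simp add: L.sum[symmetric] L.scale[symmetric] euclidean_representation)
qed

lemma smooth_on_directional_derivative:
  fixes f :: "'e::euclidean_space \<Rightarrow> 'f::real_normed_vector"
  assumes "open S" "smooth_on S f" "smooth_on S u"
  shows "smooth_on S (\<lambda>x. frechet_derivative f (at x) (u x))"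
proof (rule smooth_on_cong[OF assms(1)])
  show "smooth_on S (\<lambda>x. \<Sum>b\<in>Basis. (u x \<bullet> b) *\<^sub>R frechet_derivative f (at x) b)"
    by (intro smooth_on_sum smooth_on_scaleR smooth_on_inner smooth_on_const
      smooth_on_frechet_derivative assms)
  show "(\<Sum>b\<in>Basis. (u x \<bullet> b) *\<^sub>R frechet_derivative f (at x) b) = frechet_derivative f (at x) (u x)"
    if "x \<in> S" for x
    using frechet_derivative_in_basis smooth_on_has_derivative[OF assms(2) that]
    by (metis differentiableI)
qed

section \<open>Bump functions on Euclidean space\<close>

text \<open>
  The functions \<open>P(1/x) e\<^sup>-\<^sup>1\<^sup>/\<^sup>x\<close>, extended by \<open>0\<close> to \<open>x \<le> 0\<close>. Allowing a polynomial factor makes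
  the family closed under differentiation, so that smoothness follows by induction.
\<close>

definition flat :: "real poly \<Rightarrow> real \<Rightarrow> real" where
  "flat P x = (if 0 < x then poly P (1 / x) * exp (- (1 / x)) else 0)"

lemma poly_exp_tendsto_0: "((\<lambda>y. poly P y * exp (- y)) \<longlongrightarrow> 0) (at_top :: real filter)"
proof -
  have "((\<lambda>y. coeff P i * (y ^ i / exp y)) \<longlongrightarrow> 0) at_top" for i
    by (rule tendsto_mult_right_zero, rule tendsto_power_div_exp_0)
  then have "((\<lambda>y. \<Sum>i\<le>degree P. coeff P i * (y ^ i / exp y)) \<longlongrightarrow> 0) at_top"
    by (rule tendsto_null_sum)
  then show ?thesis
    by (simp add: poly_altdef exp_minus sum_distrib_right divide_inverse mult.assoc)
qed

lemma flat_has_derivative: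
  "(flat P has_real_derivative flat ([:0, 0, 1:] * (P - pderiv P)) x) (at x)"
proof -
  consider "0 < x" | "x < 0" | "x = 0" by linarith
  then show ?thesis
  proof cases
    case 1
    have "((\<lambda>x. poly P (1 / x) * exp (- (1 / x))) has_real_derivative
        flat ([:0, 0, 1:] * (P - pderiv P)) x) (at x)"
      using 1 by (auto intro!: derivative_eq_intros simp: flat_def field_simps power2_eq_square)
    then show ?thesis
      by (rule DERIV_cong_ev[OF refl _ refl, THEN iffD1, rotated])
        (use 1 eventually_nhds_in_open[of "{0<..}" x] in \<open>auto simp: flat_def elim: eventually_mono\<close>)
  next
    case 2
    have "((\<lambda>x. 0) has_real_derivative flat ([:0, 0, 1:] * (P - pderiv P)) x) (at x)"
      using 2 by (simp add: flat_def)
    then show ?thesis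
      by (rule DERIV_cong_ev[OF refl _ refl, THEN iffD1, rotated])
        (use 2 eventually_nhds_in_open[of "{..<0}" x] in \<open>auto simp: flat_def elim: eventually_mono\<close>)
  next
    case 3
    have "((\<lambda>x. poly ([:0, 1:] * P) (inverse x) * exp (- inverse x)) \<longlongrightarrow> 0) (at_right (0::real))"
      by (rule filterlim_compose[OF poly_exp_tendsto_0 filterlim_inverse_at_top_right])
    then have "((\<lambda>h. (flat P h - flat P 0) / h) \<longlongrightarrow> 0) (at_right 0)"
      by (rule tendsto_cong[THEN iffD1, rotated])
        (auto simp: flat_def eventually_at_filter field_simps)
    moreover have "((\<lambda>h. (flat P h - flat P 0) / h) \<longlongrightarrow> 0) (at_left 0)"
      by (rule tendsto_eventually) (auto simp: flat_def eventually_at_filter)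
    ultimately have "((\<lambda>h. (flat P h - flat P 0) / h) \<longlongrightarrow> 0) (at 0)"
      by (simp add: filterlim_split_at)
    then show ?thesis using 3 by (simp add: DERIV_def flat_def)
  qed
qed

lemma smooth_on_flat: "smooth_on UNIV (flat P)"
proof -
  have "Ck_on k UNIV (flat P)" for k
  proof (induction k arbitrary: P)
    case 0
    then show ?case using flat_has_derivative
      by (auto intro!: continuous_at_imp_continuous_on dest: DERIV_isCont)
  next
    case (Suc k)
    show ?case
    proof (rule Ck_on_SucI)
      show "(flat P has_derivative (*) (flat ([:0, 0, 1:] * (P - pderiv P)) x)) (at x)" for x
        using flat_has_derivative[of P x] unfolding has_field_derivative_def .
      show "Ck_on k UNIV (\<lambda>x. flat ([:0, 0, 1:] * (P - pderiv P)) x * u)" for u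
        by (rule Ck_on_bilinear[OF bounded_bilinear_mult open_UNIV Suc Ck_on_const])
    qed simp
  qed
  then show ?thesis by (simp add: smooth_on_def)
qed

text \<open>
  With \<open>a\<close> positive exactly for \<open>|x - x0| < 2r\<close> and \<open>b\<close> positive exactly for \<open>|x - x0| > r\<close>, the
  quotient \<open>a / (a + b)\<close> is smooth since \<open>a\<close> and \<open>b\<close> have no common zero.
\<close>

lemma euclidean_bump_function:
  fixes x0 :: "'e::euclidean_space"
  assumes "0 < r"
  obtains h :: "'e \<Rightarrow> real" where "smooth_on UNIV h"
    "\<And>x. x \<in> ball x0 r \<Longrightarrow> h x = 1" "\<And>x. x \<notin> cball x0 (2 * r) \<Longrightarrow> h x = 0"
proof -
  let ?q = "\<lambda>x. (x - x0) \<bullet> (x - x0)"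
  let ?a = "\<lambda>x. flat 1 (4 * r\<^sup>2 - ?q x)" and ?b = "\<lambda>x. flat 1 (?q x - r\<^sup>2)"
  have nonneg: "0 \<le> flat 1 t" and pos: "0 < flat 1 t \<longleftrightarrow> 0 < t" for t
    by (auto simp: flat_def)
  have d: "smooth_on UNIV (\<lambda>x. x - x0)"
    using smooth_on_add[OF open_UNIV smooth_on_ident[OF open_UNIV] smooth_on_const, of "- x0"] by simp
  have q: "smooth_on UNIV ?q"
    by (intro smooth_on_inner open_UNIV d)
  have "smooth_on UNIV (\<lambda>x. 4 * r\<^sup>2 + (- 1) * ?q x)" "smooth_on UNIV (\<lambda>x. ?q x + (- r\<^sup>2))"
    by (intro smooth_on_add smooth_on_mult open_UNIV smooth_on_const q)+
  from this[THEN smooth_on_compose[OF open_UNIV open_UNIV subset_UNIV _ smooth_on_flat[of 1]]]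
  have a: "smooth_on UNIV ?a" and b: "smooth_on UNIV ?b"
    by (simp_all add: o_def)
  have sum_pos: "0 < ?a x + ?b x" for x
  proof -
    have "0 < 4 * r\<^sup>2 - ?q x \<or> 0 < ?q x - r\<^sup>2" using assms zero_less_power[OF assms, of 2] by linarith
    then show ?thesis using nonneg pos by (metis add_nonneg_pos add_pos_nonneg)
  qed
  have "smooth_on UNIV (inverse \<circ> (\<lambda>x. ?a x + ?b x))"
    by (rule smooth_on_compose[where T = "- {0}"])
      (use sum_pos in \<open>auto simp: smooth_on_def[of "- {0}"] Ck_on_inverse intro!: smooth_on_add a b\<close>,
        metis less_irrefl)
  then have "smooth_on UNIV (\<lambda>x. ?a x * inverse (?a x + ?b x))"
    by (intro smooth_on_mult a open_UNIV) (simp add: o_def)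
  moreover have "?q x = (dist x0 x)\<^sup>2" for x
    by (metis dist_norm dist_commute power2_norm_eq_inner)
  then have "?b x = 0" if "x \<in> ball x0 r" for x
    using that power_mono[of "dist x0 x" r 2] by (simp add: flat_def)
  then have "?a x * inverse (?a x + ?b x) = 1" if "x \<in> ball x0 r" for x
    using sum_pos[of x] that by simp
  moreover have "?a x = 0" if "x \<notin> cball x0 (2 * r)" for x
    using power_mono[of "2 * r" "dist x0 x" 2] that assms \<open>?q x = (dist x0 x)\<^sup>2\<close>
    by (simp add: flat_def power_mult_distrib)
  ultimately show ?thesis by (intro that[of "\<lambda>x. ?a x * inverse (?a x + ?b x)"]) simp_all
qed

section \<open>Atlases with bump functions\<close>

text \<open>
  \<open>c\<close> is smooth and vanishes near every point outside \<open>U\<close>, where nearness is measured in charts. This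
  is the property of a function with closed support in \<open>U\<close> that makes \<open>c f\<close>, extended by \<open>0\<close>, smooth
  for every smooth \<open>f\<close> on \<open>U\<close>.
\<close>

definition cutoff :: "('a, 'e::euclidean_space) atlas \<Rightarrow> 'a set \<Rightarrow> ('a \<Rightarrow> real) \<Rightarrow> bool" where
  "cutoff A U c \<longleftrightarrow> c \<in> smooth_funs A \<and>
     (\<forall>(V, \<psi>)\<in>A. \<forall>p\<in>V - U. \<exists>N. open N \<and> \<psi> p \<in> N \<and> N \<subseteq> \<psi> ` V \<and> (\<forall>y\<in>N. c (inv_into V \<psi> y) = 0))"

text \<open>
  The part of the manifold axioms that the calculus of vector fields and 1-forms uses. The existence
  of bump functions replaces the topological axioms, because it passes directly to the cotangent
  bundle.
\<close>

locale bump_atlas =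
  fixes A :: "('a, 'e::euclidean_space) atlas"
  assumes chart_inj: "(U, \<phi>) \<in> A \<Longrightarrow> inj_on \<phi> U"
    and chart_open: "(U, \<phi>) \<in> A \<Longrightarrow> open (\<phi> ` U)"
    and overlap_open: "(U, \<phi>) \<in> A \<Longrightarrow> (V, \<psi>) \<in> A \<Longrightarrow> open (\<phi> ` (U \<inter> V))"
    and transition: "(U, \<phi>) \<in> A \<Longrightarrow> (V, \<psi>) \<in> A \<Longrightarrow>
      smooth_on (\<phi> ` (U \<inter> V)) (\<psi> \<circ> inv_into U \<phi>)"
    and bump: "(U, \<phi>) \<in> A \<Longrightarrow> m \<in> U \<Longrightarrow> \<exists>c. cutoff A U c \<and>
      (\<exists>N. open N \<and> \<phi> m \<in> N \<and> N \<subseteq> \<phi> ` U \<and> (\<forall>x\<in>N. c (inv_into U \<phi> x) = 1))"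

text \<open>
  Charts are open maps for the topology they generate: the image of a generator is the preimage of an
  open set under a transition map.
\<close>

lemma chart_image_open:
  assumes "smooth_manifold A" "(U, \<phi>) \<in> A" "openin (atlas_topology A) W"
  shows "open (\<phi> ` (U \<inter> W))"
proof -
  have inj: "inj_on \<phi> U" and ov: "\<And>V \<psi>. (V, \<psi>) \<in> A \<Longrightarrow> open (\<phi> ` (U \<inter> V))"
    and tr: "\<And>V \<psi>. (V, \<psi>) \<in> A \<Longrightarrow> smooth_on (\<phi> ` (U \<inter> V)) (\<psi> \<circ> inv_into U \<phi>)"
    using assms(1,2) by (auto simp: smooth_manifold_def)
  have "generate_topology_on {V \<inter> \<psi> -` S | V \<psi> S. (V, \<psi>) \<in> A \<and> open S} W"
    using assms(3) by (simp add: atlas_topology_def openin_topology_generated_by_iff)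
  then show ?thesis
  proof induction
    case Empty
    then show ?case by simp
  next
    case (Int a b)
    have "\<phi> ` (U \<inter> (a \<inter> b)) = \<phi> ` (U \<inter> a) \<inter> \<phi> ` (U \<inter> b)"
      using inj by (auto simp: inj_on_def)
    then show ?case using Int by auto
  next
    case (UN K)
    have "\<phi> ` (U \<inter> \<Union>K) = (\<Union>k\<in>K. \<phi> ` (U \<inter> k))" by auto
    then show ?case using UN by auto
  next
    case (Basis s)
    then obtain V \<psi> S where s: "s = V \<inter> \<psi> -` S" "(V, \<psi>) \<in> A" "open S" by auto
    have "\<phi> ` (U \<inter> s) = \<phi> ` (U \<inter> V) \<inter> (\<psi> \<circ> inv_into U \<phi>) -` S"
      using inj by (auto simp: s(1))
    moreover have "continuous_on (\<phi> ` (U \<inter> V)) (\<psi> \<circ> inv_into U \<phi>)"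
      using tr[OF s(2)] by (metis Ck_on.simps(1) smooth_on_def)
    ultimately show ?case
      using continuous_open_preimage[OF _ ov[OF s(2)] s(3)] by metis
  qed
qed

lemma topspace_atlas_topology: "topspace (atlas_topology A) = points A"
proof -
  have "\<Union> {U \<inter> \<phi> -` V | U \<phi> V. (U, \<phi>) \<in> A \<and> open V} = points A"
    unfolding points_def by (auto, metis open_UNIV IntI UNIV_I vimageI2)
  then show ?thesis
    by (simp add: atlas_topology_def)
qed

text \<open>
  The inverse of a chart is continuous, so it maps compact sets to compact sets, which are closed in
  a Hausdorff space.
\<close>

lemma closed_image_of_compact:
  assumes "smooth_manifold A" "(U, \<phi>) \<in> A" "compact K" "K \<subseteq> \<phi> ` U"
  shows "closedin (atlas_topology A) (inv_into U \<phi> ` K)"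
proof -
  have inj: "inj_on \<phi> U" and op: "open (\<phi> ` U)"
    using assms(1,2) by (auto simp: smooth_manifold_def)
  have "continuous_map (top_of_set (\<phi> ` U)) (atlas_topology A) (inv_into U \<phi>)"
    unfolding continuous_map
  proof (intro conjI allI impI)
    show "inv_into U \<phi> ` topspace (top_of_set (\<phi> ` U)) \<subseteq> topspace (atlas_topology A)"
      using assms(2) inj by (auto simp: topspace_atlas_topology points_def)
    fix W assume W: "openin (atlas_topology A) W"
    have "{x \<in> topspace (top_of_set (\<phi> ` U)). inv_into U \<phi> x \<in> W} = \<phi> ` (U \<inter> W)"
      using inj by auto
    then show "openin (top_of_set (\<phi> ` U)) {x \<in> topspace (top_of_set (\<phi> ` U)). inv_into U \<phi> x \<in> W}"
      using chart_image_open[OF assms(1,2) W] op by (auto simp: openin_open_eq)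
  qed
  then have "compactin (atlas_topology A) (inv_into U \<phi> ` K)"
    using assms(3,4) by (intro image_compactin) (auto simp: compactin_subtopology)
  then show ?thesis
    using assms(1) by (intro compactin_imp_closedin) (auto simp: smooth_manifold_def)
qed

text \<open>
  A Euclidean bump function around \<open>\<phi> m\<close>, transported by the chart and extended by \<open>0\<close>.
\<close>

lemma smooth_manifold_bump_atlas:
  assumes M: "smooth_manifold A"
  shows "bump_atlas A"
proof
  note smooth_manifold_def[simp]
  show inj: "inj_on \<phi> U" and op: "open (\<phi> ` U)" if "(U, \<phi>) \<in> A" for U \<phi>
    using M that by auto
  show ov: "open (\<phi> ` (U \<inter> V))" and tr: "smooth_on (\<phi> ` (U \<inter> V)) (\<psi> \<circ> inv_into U \<phi>)"
    if "(U, \<phi>) \<in> A" "(V, \<psi>) \<in> A" for U \<phi> V \<psi>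
    using M that by auto
  fix U \<phi> m
  assume U: "(U, \<phi>) \<in> A" and m: "m \<in> U"
  obtain r where r: "0 < r" "cball (\<phi> m) (2 * r) \<subseteq> \<phi> ` U"
  proof -
    obtain e where "0 < e" "cball (\<phi> m) e \<subseteq> \<phi> ` U"
      using op[OF U] m open_contains_cball by blast
    then show ?thesis by (intro that[of "e / 2"]) auto
  qed
  obtain h :: "'b \<Rightarrow> real" where h: "smooth_on UNIV h" "\<And>x. x \<in> ball (\<phi> m) r \<Longrightarrow> h x = 1"
    "\<And>x. x \<notin> cball (\<phi> m) (2 * r) \<Longrightarrow> h x = 0"
    using euclidean_bump_function[OF r(1)] by blast
  define c where "c p = (if p \<in> U then h (\<phi> p) else 0)" for p
  define K where "K = inv_into U \<phi> ` cball (\<phi> m) (2 * r)"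
  have closed: "closedin (atlas_topology A) K"
    unfolding K_def by (rule closed_image_of_compact[OF M U compact_cball r(2)])
  have K: "K \<subseteq> U" using r(2) by (auto simp: K_def inv_into_into)
  have c0: "c p = 0" if "p \<notin> K" for p
  proof (cases "p \<in> U")
    case True
    then have "\<phi> p \<notin> cball (\<phi> m) (2 * r)"
      using that inj[OF U] unfolding K_def by (metis image_eqI inv_into_f_f)
    then show ?thesis using h(3) by (simp add: c_def)
  qed (simp add: c_def)
  \<comment> \<open>This is where the Hausdorff property enters: \<open>K\<close> is closed, so \<open>c\<close> vanishes near every
    point outside \<open>U\<close>.\<close>
  have away: "open (\<psi> ` (V - K))" if "(V, \<psi>) \<in> A" for V \<psi>
  proof -
    have "openin (atlas_topology A) (points A - K)"
      using closed topspace_atlas_topology by (metis openin_diff openin_topspace)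
    then have "open (\<psi> ` (V \<inter> (points A - K)))" by (rule chart_image_open[OF M that])
    moreover have "V \<inter> (points A - K) = V - K" using that by (auto simp: points_def)
    ultimately show ?thesis by simp
  qed
  have "c \<in> smooth_funs A"
    unfolding smooth_funs_def
  proof clarify
    fix V \<psi> assume V: "(V, \<psi>) \<in> A"
    show "smooth_on (\<psi> ` V) (c \<circ> inv_into V \<psi>)"
    proof (rule smooth_on_local[OF op[OF V]], elim imageE)
      fix y p assume p: "y = \<psi> p" "p \<in> V"
      show "\<exists>T. open T \<and> y \<in> T \<and> smooth_on T (c \<circ> inv_into V \<psi>)"
      proof (cases "p \<in> U")
        case True
        have "smooth_on (\<psi> ` (V \<inter> U)) (h \<circ> (\<phi> \<circ> inv_into V \<psi>))"
          by (rule smooth_on_compose[OF ov[OF V U] open_UNIV subset_UNIV tr[OF V U] h(1)])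
        then have "smooth_on (\<psi> ` (V \<inter> U)) (c \<circ> inv_into V \<psi>)"
          by (rule smooth_on_cong[OF ov[OF V U], rotated])
            (use inj[OF V] in \<open>auto simp: c_def\<close>)
        then show ?thesis using ov[OF V U] True p by blast
      next
        case False
        have "smooth_on (\<psi> ` (V - K)) (\<lambda>_. 0 :: real)" by (rule smooth_on_const)
        then have "smooth_on (\<psi> ` (V - K)) (c \<circ> inv_into V \<psi>)"
          by (rule smooth_on_cong[OF away[OF V], rotated])
            (use inj[OF V] c0 in \<open>auto simp: inv_into_f_f\<close>)
        then show ?thesis using away[OF V] False K p by blast
      qed
    qed
  qed
  moreover have "\<exists>N. open N \<and> \<psi> p \<in> N \<and> N \<subseteq> \<psi> ` V \<and> (\<forall>y\<in>N. c (inv_into V \<psi> y) = 0)"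
    if "(V, \<psi>) \<in> A" "p \<in> V - U" for V \<psi> p
    by (rule exI[of _ "\<psi> ` (V - K)"])
      (use away[OF that(1)] that(2) K inj[OF that(1)] c0 in \<open>auto simp: inv_into_f_f\<close>)
  ultimately have "cutoff A U c" unfolding cutoff_def by blast
  moreover have "c (inv_into U \<phi> x) = 1" if "x \<in> ball (\<phi> m) r" for x
  proof -
    have "x \<in> \<phi> ` U" using r that by (auto intro!: subsetD[OF r(2)])
    then show ?thesis using h(2)[OF that] by (simp add: c_def inv_into_into f_inv_into_f)
  qed
  moreover have "ball (\<phi> m) r \<subseteq> \<phi> ` U"
    using r by (intro subset_trans[OF _ r(2)]) auto
  ultimately show "\<exists>c. cutoff A U c \<and>
      (\<exists>N. open N \<and> \<phi> m \<in> N \<and> N \<subseteq> \<phi> ` U \<and> (\<forall>x\<in>N. c (inv_into U \<phi> x) = 1))"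
    using r(1) by (metis centre_in_ball open_ball)
qed

text \<open>
  The coordinate vector of a tangent vector: the inverse of \<open>coord_vec A C m\<close>.
\<close>

definition coords :: "('a, 'e::euclidean_space) atlas \<Rightarrow> ('a, 'e) chart \<Rightarrow> 'a \<Rightarrow> 'a tvec \<Rightarrow> 'e" where
  "coords A C m v = (THE u. coord_vec A C m u = v)"

text \<open>
  The covector at \<open>m\<close> with components \<open>q\<close> in the chart \<open>C\<close>.
\<close>

definition covec :: "('a, 'e::euclidean_space) atlas \<Rightarrow> ('a, 'e) chart \<Rightarrow> 'a \<Rightarrow> 'e \<Rightarrow> 'a cvec" where
  "covec A C m q = (\<lambda>v. if v \<in> tangent_space A m then q \<bullet> coords A C m v else 0)"

lemma smooth_funs_chart: "f \<in> smooth_funs A \<Longrightarrow> (U, \<phi>) \<in> A \<Longrightarrow> smooth_on (\<phi> ` U) (f \<circ> inv_into U \<phi>)"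
  by (auto simp: smooth_funs_def)

context bump_atlas
begin

lemma chart_inverse [simp]: "(U, \<phi>) \<in> A \<Longrightarrow> m \<in> U \<Longrightarrow> inv_into U \<phi> (\<phi> m) = m"
  using chart_inj by simp

lemma pointsE: assumes "m \<in> points A" obtains U \<phi> where "(U, \<phi>) \<in> A" "m \<in> U"
  using assms by (auto simp: points_def)

lemma pointsI: "(U, \<phi>) \<in> A \<Longrightarrow> m \<in> U \<Longrightarrow> m \<in> points A"
  by (auto simp: points_def)

lemma smooth_funs_const: "(\<lambda>_. c) \<in> smooth_funs A"
  by (auto simp: smooth_funs_def o_def smooth_on_const)

lemma smooth_funs_add: "f \<in> smooth_funs A \<Longrightarrow> g \<in> smooth_funs A \<Longrightarrow> (\<lambda>p. f p + g p) \<in> smooth_funs A"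
  using chart_open by (auto simp: smooth_funs_def o_def intro!: smooth_on_add)

lemma smooth_funs_mult: "f \<in> smooth_funs A \<Longrightarrow> g \<in> smooth_funs A \<Longrightarrow> (\<lambda>p. f p * g p) \<in> smooth_funs A"
  using chart_open by (auto simp: smooth_funs_def o_def intro!: smooth_on_mult)

lemma smooth_funs_diff: 
  assumes "f \<in> smooth_funs A" "g \<in> smooth_funs A"
  shows "(\<lambda>p. f p - g p) \<in> smooth_funs A"
  using smooth_funs_add[OF assms(1) smooth_funs_mult[OF smooth_funs_const[of "- 1"] assms(2)]] by simp

lemma smooth_funs_cong:
  assumes "f \<in> smooth_funs A" "\<And>p. p \<in> points A \<Longrightarrow> f p = g p"
  shows "g \<in> smooth_funs A"
  unfolding smooth_funs_def
proof clarify
  fix U \<phi> assume U: "(U, \<phi>) \<in> A"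
  show "smooth_on (\<phi> ` U) (g \<circ> inv_into U \<phi>)"
    by (rule smooth_on_cong[OF chart_open[OF U] _ smooth_funs_chart[OF assms(1) U]])
      (use assms(2) pointsI[OF U] in \<open>auto simp: inv_into_into\<close>)
qed

text \<open>
  Smoothness is local. Near a point of \<open>U\<close> the function is a product of smooth functions, and near any
  other point it is zero by the choice of \<open>c\<close>.
\<close>

lemma extend_smooth:
  assumes U: "(U, \<phi>) \<in> A" and c: "cutoff A U c" and f: "smooth_on (\<phi> ` U) (f \<circ> inv_into U \<phi>)"
  shows "(\<lambda>p. if p \<in> U then c p * f p else 0) \<in> smooth_funs A" (is "?F \<in> _")
  unfolding smooth_funs_def
proof clarify
  fix V \<psi> assume V: "(V, \<psi>) \<in> A"
  show "smooth_on (\<psi> ` V) (?F \<circ> inv_into V \<psi>)"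
  proof (rule smooth_on_local[OF chart_open[OF V]], elim imageE)
    fix y p assume p: "y = \<psi> p" "p \<in> V"
    show "\<exists>T. open T \<and> y \<in> T \<and> smooth_on T (?F \<circ> inv_into V \<psi>)"
    proof (cases "p \<in> U")
      case True
      let ?W = "\<psi> ` (V \<inter> U)"
      note W = overlap_open[OF V U]
      have "smooth_on ?W ((f \<circ> inv_into U \<phi>) \<circ> (\<phi> \<circ> inv_into V \<psi>))"
        by (rule smooth_on_compose[OF W chart_open[OF U] _ transition[OF V U] f]) (use V in auto)
      moreover have "smooth_on ?W (c \<circ> inv_into V \<psi>)"
        using c V by (auto simp: cutoff_def intro: smooth_on_subset[OF smooth_funs_chart])
      ultimately have "smooth_on ?W (\<lambda>y. (c \<circ> inv_into V \<psi>) y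
          * ((f \<circ> inv_into U \<phi>) \<circ> (\<phi> \<circ> inv_into V \<psi>)) y)"
        by (intro smooth_on_mult[OF W])
      then have "smooth_on ?W (?F \<circ> inv_into V \<psi>)"
        by (rule smooth_on_cong[OF W, rotated]) (use U V in auto)
      then show ?thesis using W True p by blast
    next
      case False
      with c V p obtain N where N: "open N" "\<psi> p \<in> N" "\<forall>y\<in>N. c (inv_into V \<psi> y) = 0"
        unfolding cutoff_def by blast
      have "smooth_on N (\<lambda>_. 0 :: real)" by (rule smooth_on_const)
      then have "smooth_on N (?F \<circ> inv_into V \<psi>)"
        by (rule smooth_on_cong[OF N(1), rotated]) (use N(3) in auto)
      then show ?thesis using N p by blast
    qed
  qed
qed

lemma cutoff_zero:
  assumes "cutoff A U c" "p \<in> points A" "p \<notin> U"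
  shows "c p = 0"
proof -
  obtain V \<psi> where V: "(V, \<psi>) \<in> A" "p \<in> V" using assms(2) by (rule pointsE)
  then obtain N where "\<psi> p \<in> N" "\<forall>y\<in>N. c (inv_into V \<psi> y) = 0"
    using assms(1,3) unfolding cutoff_def by blast
  then show ?thesis using V by force
qed

lemma bumpE:
  assumes "(U, \<phi>) \<in> A" "m \<in> U"
  obtains c N where "cutoff A U c" "c m = 1" "open N" "\<phi> m \<in> N" "N \<subseteq> \<phi> ` U"
    "\<And>x. x \<in> N \<Longrightarrow> c (inv_into U \<phi> x) = 1"
  using bump[OF assms] assms by (metis chart_inverse)

section \<open>Tangent vectors in charts\<close>

lemma chart_at_open:
  assumes "(U, \<phi>) \<in> A" "x \<in> \<phi> ` U"
  shows "inv_into U \<phi> x \<in> U" "\<phi> (inv_into U \<phi> x) = x" "inv_into U \<phi> x \<in> points A"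
  using assms by (auto simp: f_inv_into_f inv_into_into pointsI)

lemma smooth_fun_has_derivative:
  assumes "f \<in> smooth_funs A" "(U, \<phi>) \<in> A" "m \<in> U"
  shows "((f \<circ> inv_into U \<phi>) has_derivative frechet_derivative (f \<circ> inv_into U \<phi>) (at (\<phi> m))) (at (\<phi> m))"
  using smooth_on_has_derivative[OF smooth_funs_chart[OF assms(1,2)]] assms(3) by auto

lemma coord_vec_apply:
  "f \<in> smooth_funs A \<Longrightarrow>
    coord_vec A (U, \<phi>) m u f = frechet_derivative (f \<circ> inv_into U \<phi>) (at (\<phi> m)) u"
  by (simp add: coord_vec_def)

text \<open>
  The chain rule for the transition map. It shows that a tangent vector given in one chart has
  coordinates in every other chart at the same point.
\<close>

lemma coord_vec_change:
  assumes U: "(U, \<phi>) \<in> A" "m \<in> U" and V: "(V, \<psi>) \<in> A" "m \<in> V"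
  shows "coord_vec A (U, \<phi>) m u =
    coord_vec A (V, \<psi>) m (frechet_derivative (\<psi> \<circ> inv_into U \<phi>) (at (\<phi> m)) u)"
proof
  fix f
  let ?t = "\<psi> \<circ> inv_into U \<phi>"
  show "coord_vec A (U, \<phi>) m u f = coord_vec A (V, \<psi>) m (frechet_derivative ?t (at (\<phi> m)) u) f"
  proof (cases "f \<in> smooth_funs A")
    case f: True
    have m: "\<phi> m \<in> \<phi> ` (U \<inter> V)" "?t (\<phi> m) = \<psi> m" using U V by auto
    have "((f \<circ> inv_into V \<psi>) \<circ> ?t has_derivative
        frechet_derivative (f \<circ> inv_into V \<psi>) (at (\<psi> m)) \<circ> frechet_derivative ?t (at (\<phi> m))) (at (\<phi> m))"
      using diff_chain_at[OF smooth_on_has_derivative[OF transition[OF U(1) V(1)] m(1)]]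
        smooth_fun_has_derivative[OF f V] m(2) by metis
    then have "((f \<circ> inv_into U \<phi>) has_derivative
        frechet_derivative (f \<circ> inv_into V \<psi>) (at (\<psi> m)) \<circ> frechet_derivative ?t (at (\<phi> m))) (at (\<phi> m))"
      by (rule has_derivative_transform_within_open[OF _ overlap_open[OF U(1) V(1)] m(1)])
        (use U V in auto)
    from frechet_derivative_at[OF this, THEN fun_cong, of u] f show ?thesis
      by (simp add: coord_vec_apply)
  qed (simp add: coord_vec_def)
qed

lemma coord_vec_tangent: "(U, \<phi>) \<in> A \<Longrightarrow> m \<in> U \<Longrightarrow> coord_vec A (U, \<phi>) m u \<in> tangent_space A m"
  by (auto simp: tangent_space_def)

lemma tangent_space_chart:
  assumes "(U, \<phi>) \<in> A" "m \<in> U"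
  shows "tangent_space A m = range (coord_vec A (U, \<phi>) m)"
proof
  show "tangent_space A m \<subseteq> range (coord_vec A (U, \<phi>) m)"
    unfolding tangent_space_def using coord_vec_change[OF _ _ assms] by blast
  show "range (coord_vec A (U, \<phi>) m) \<subseteq> tangent_space A m"
    using coord_vec_tangent[OF assms] by blast
qed

lemma coord_vec_lin:
  assumes "(U, \<phi>) \<in> A" "m \<in> U"
  shows "coord_vec A (U, \<phi>) m (a *\<^sub>R u + b *\<^sub>R w) =
    (\<lambda>f. a * coord_vec A (U, \<phi>) m u f + b * coord_vec A (U, \<phi>) m w f)"
proof
  fix f
  show "coord_vec A (U, \<phi>) m (a *\<^sub>R u + b *\<^sub>R w) f =
    a * coord_vec A (U, \<phi>) m u f + b * coord_vec A (U, \<phi>) m w f"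
  proof (cases "f \<in> smooth_funs A")
    case True
    interpret linear "frechet_derivative (f \<circ> inv_into U \<phi>) (at (\<phi> m))"
      using smooth_fun_has_derivative[OF True assms] by (rule has_derivative_linear)
    show ?thesis using True by (simp add: coord_vec_apply add scale)
  qed (simp add: coord_vec_def)
qed

lemma local_extension:
  assumes U: "(U, \<phi>) \<in> A" "m \<in> U" and f: "smooth_on (\<phi> ` U) f"
  obtains F N where "F \<in> smooth_funs A" "open N" "\<phi> m \<in> N" "N \<subseteq> \<phi> ` U"
    "\<And>x. x \<in> N \<Longrightarrow> F (inv_into U \<phi> x) = f x"
proof -
  obtain c N where c: "cutoff A U c" "open N" "\<phi> m \<in> N" "N \<subseteq> \<phi> ` U"
    "\<And>x. x \<in> N \<Longrightarrow> c (inv_into U \<phi> x) = 1" using bumpE[OF U] by metis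
  have "smooth_on (\<phi> ` U) ((\<lambda>p. f (\<phi> p)) \<circ> inv_into U \<phi>)"
    by (rule smooth_on_cong[OF chart_open[OF U(1)] _ f]) (use U in auto)
  from extend_smooth[OF U(1) c(1) this] show ?thesis
    by (rule that[OF _ c(2-4)]) (use c(4,5) chart_at_open[OF U(1)] in auto)
qed

text \<open>
  Globally smooth functions that agree near \<open>m\<close> with a coordinate. They read off coordinates of
  tangent vectors, and are used to show that coordinates are unique and that vector fields have smooth
  coordinates.
\<close>

lemma coordinate_function:
  assumes U: "(U, \<phi>) \<in> A" "m \<in> U"
  obtains s N where "s \<in> smooth_funs A" "open N" "\<phi> m \<in> N" "N \<subseteq> \<phi> ` U"
    "\<And>x u. x \<in> N \<Longrightarrow> coord_vec A (U, \<phi>) (inv_into U \<phi> x) u s = u \<bullet> b"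
proof -
  have "smooth_on (\<phi> ` U) (\<lambda>x. x \<bullet> b)"
    by (intro smooth_on_linear[OF bounded_linear_inner_left] smooth_on_ident chart_open[OF U(1)])
  then obtain s N where s: "s \<in> smooth_funs A" and N: "open N" "\<phi> m \<in> N" "N \<subseteq> \<phi> ` U"
    and eq: "\<And>x. x \<in> N \<Longrightarrow> s (inv_into U \<phi> x) = x \<bullet> b"
    by (rule local_extension[OF U]) blast
  show ?thesis
  proof (rule that[OF s N])
    fix x u assume x: "x \<in> N"
    have "((\<lambda>x. x \<bullet> b) has_derivative (\<lambda>u. u \<bullet> b)) (at x)"
      by (auto intro: derivative_eq_intros)
    then have "((s \<circ> inv_into U \<phi>) has_derivative (\<lambda>u. u \<bullet> b)) (at x)"
      by (rule has_derivative_transform_within_open[OF _ N(1) x]) (simp add: eq)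
    from frechet_derivative_at[OF this, THEN fun_cong, of u]
    show "coord_vec A (U, \<phi>) (inv_into U \<phi> x) u s = u \<bullet> b"
      using s chart_at_open[OF U(1) subsetD[OF N(3) x]] by (simp add: coord_vec_apply)
  qed
qed

lemma coord_vec_inj:
  assumes "(U, \<phi>) \<in> A" "m \<in> U" "coord_vec A (U, \<phi>) m u = coord_vec A (U, \<phi>) m w"
  shows "u = w"
proof (rule euclidean_eqI)
  fix b :: 'e
  obtain s N where "\<phi> m \<in> N"
    "\<And>x u. x \<in> N \<Longrightarrow> coord_vec A (U, \<phi>) (inv_into U \<phi> x) u s = u \<bullet> b"
    using coordinate_function[OF assms(1,2)] by metis
  then show "u \<bullet> b = w \<bullet> b" using assms by (metis chart_inverse)
qed

lemma coords_coord_vec [simp]: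
  "(U, \<phi>) \<in> A \<Longrightarrow> m \<in> U \<Longrightarrow> coords A (U, \<phi>) m (coord_vec A (U, \<phi>) m u) = u"
  unfolding coords_def using coord_vec_inj by blast

lemma coord_vec_coords:
  assumes "(U, \<phi>) \<in> A" "m \<in> U" "v \<in> tangent_space A m"
  shows "coord_vec A (U, \<phi>) m (coords A (U, \<phi>) m v) = v"
  using assms tangent_space_chart[OF assms(1,2)] by auto

lemma tangent_point: "v \<in> tangent_space A m \<Longrightarrow> m \<in> points A"
  by (auto simp: tangent_space_def points_def)

lemma coords_lin:
  assumes "(U, \<phi>) \<in> A" "m \<in> U" "v \<in> tangent_space A m" "w \<in> tangent_space A m"
  shows "coords A (U, \<phi>) m (\<lambda>f. a * v f + b * w f)
    = a *\<^sub>R coords A (U, \<phi>) m v + b *\<^sub>R coords A (U, \<phi>) m w"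
  using arg_cong[OF coord_vec_lin[OF assms(1,2), of a "coords A (U, \<phi>) m v" b "coords A (U, \<phi>) m w"],
      of "coords A (U, \<phi>) m"]
  by (simp add: coord_vec_coords assms)

lemma tangent_lin:
  assumes "v \<in> tangent_space A m" "w \<in> tangent_space A m"
  shows "(\<lambda>f. a * v f + b * w f) \<in> tangent_space A m"
proof -
  obtain U \<phi> where U: "(U, \<phi>) \<in> A" "m \<in> U" using assms tangent_point pointsE by metis
  show ?thesis
    using coord_vec_tangent[OF U, of "a *\<^sub>R coords A (U, \<phi>) m v + b *\<^sub>R coords A (U, \<phi>) m w"]
    by (simp add: coord_vec_lin[OF U] coord_vec_coords[OF U] assms)
qed

lemma tangent_zero: "m \<in> points A \<Longrightarrow> (\<lambda>_. 0) \<in> tangent_space A m"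
  using tangent_lin[of _ m _ 0 0] by (auto elim!: pointsE dest: coord_vec_tangent)

text \<open>
  The last property says that values outside the manifold are invisible to tangent vectors; it allows
  replacing a function by one that is given by a convenient formula on the manifold only.
\<close>

lemma tangent_derivation:
  assumes v: "v \<in> tangent_space A m"
  shows "f \<in> smooth_funs A \<Longrightarrow> g \<in> smooth_funs A \<Longrightarrow> v (\<lambda>p. f p + g p) = v f + v g"
    and "f \<in> smooth_funs A \<Longrightarrow> g \<in> smooth_funs A \<Longrightarrow> v (\<lambda>p. f p * g p) = f m * v g + g m * v f"
    and "v (\<lambda>p. k) = 0"
    and "f \<in> smooth_funs A \<Longrightarrow> (\<And>p. p \<in> points A \<Longrightarrow> f p = g p) \<Longrightarrow> v f = v g"
proof -
  obtain U \<phi> where U: "(U, \<phi>) \<in> A" "m \<in> U" using v tangent_point pointsE by metis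
  obtain u where u: "v = coord_vec A (U, \<phi>) m u" using v tangent_space_chart[OF U] by auto
  note D = smooth_fun_has_derivative[OF _ U]
  note [simp] = smooth_funs_add smooth_funs_mult smooth_funs_const U
  show "v (\<lambda>p. f p + g p) = v f + v g" if fg: "f \<in> smooth_funs A" "g \<in> smooth_funs A"
    using frechet_derivative_at[OF has_derivative_add[OF D[OF fg(1)] D[OF fg(2)]], THEN fun_cong, of u] fg
    by (simp add: u coord_vec_apply o_def)
  show "v (\<lambda>p. f p * g p) = f m * v g + g m * v f" if fg: "f \<in> smooth_funs A" "g \<in> smooth_funs A"
    using frechet_derivative_at[OF has_derivative_mult[OF D[OF fg(1)] D[OF fg(2)]], THEN fun_cong, of u] fg
    by (simp add: u coord_vec_apply o_def mult.commute)
  show "v (\<lambda>p. k) = 0"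
    by (simp add: u coord_vec_apply o_def)
  show "v f = v g" if f: "f \<in> smooth_funs A" "\<And>p. p \<in> points A \<Longrightarrow> f p = g p"
  proof -
    have "g \<in> smooth_funs A" using smooth_funs_cong f by blast
    moreover have "frechet_derivative (f \<circ> inv_into U \<phi>) (at (\<phi> m))
        = frechet_derivative (g \<circ> inv_into U \<phi>) (at (\<phi> m))"
      by (rule frechet_derivative_cong_open[OF chart_open[OF U(1)]])
        (use U f(2) chart_at_open[OF U(1)] in auto)
    ultimately show ?thesis using f by (simp add: u coord_vec_apply)
  qed
qed

lemma tangent_nonsmooth: "v \<in> tangent_space A m \<Longrightarrow> f \<notin> smooth_funs A \<Longrightarrow> v f = 0"
  by (auto simp: tangent_space_def coord_vec_def)

section \<open>Vector fields and tensoriality\<close>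

lemma vfields_tangent: "X \<in> vfields A \<Longrightarrow> m \<in> points A \<Longrightarrow> X m \<in> tangent_space A m"
  by (simp add: vfields_def)

lemma vfields_smooth: "X \<in> vfields A \<Longrightarrow> f \<in> smooth_funs A \<Longrightarrow> (\<lambda>m. X m f) \<in> smooth_funs A"
  by (simp add: vfields_def)

text \<open>
  Near each point the component along \<open>b\<close> is \<open>Y s\<close>, where \<open>s\<close> is a global function extending the
  coordinate.
\<close>

lemma smooth_on_coords:
  assumes U: "(U, \<phi>) \<in> A" and Y: "Y \<in> vfields A"
  shows "smooth_on (\<phi> ` U) (\<lambda>x. coords A (U, \<phi>) (inv_into U \<phi> x) (Y (inv_into U \<phi> x)))"
proof (rule smooth_on_components[OF chart_open[OF U]], rule smooth_on_local[OF chart_open[OF U]])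
  fix b :: 'e and y assume y: "y \<in> \<phi> ` U"
  obtain s N where s: "s \<in> smooth_funs A" and N: "open N" "y \<in> N" "N \<subseteq> \<phi> ` U"
    "\<And>x u. x \<in> N \<Longrightarrow> coord_vec A (U, \<phi>) (inv_into U \<phi> x) u s = u \<bullet> b"
    using coordinate_function[OF U, of "inv_into U \<phi> y"] chart_at_open[OF U y] by metis
  have "smooth_on N ((\<lambda>m. Y m s) \<circ> inv_into U \<phi>)"
    by (rule smooth_on_subset[OF smooth_funs_chart[OF vfields_smooth[OF Y s] U] N(3)])
  then have "smooth_on N (\<lambda>x. coords A (U, \<phi>) (inv_into U \<phi> x) (Y (inv_into U \<phi> x)) \<bullet> b)"
  proof (rule smooth_on_cong[OF N(1), rotated])
    fix x assume x: "x \<in> N"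
    then have "x \<in> \<phi> ` U" using N(3) by auto
    note x' = chart_at_open[OF U this]
    show "((\<lambda>m. Y m s) \<circ> inv_into U \<phi>) x
        = coords A (U, \<phi>) (inv_into U \<phi> x) (Y (inv_into U \<phi> x)) \<bullet> b"
      using N(4)[OF x] coord_vec_coords[OF U x'(1) vfields_tangent[OF Y x'(3)]] by (metis comp_apply)
  qed
  then show "\<exists>T. open T \<and> y \<in> T \<and>
      smooth_on T (\<lambda>x. coords A (U, \<phi>) (inv_into U \<phi> x) (Y (inv_into U \<phi> x)) \<bullet> b)"
    using N by blast
qed

text \<open>
  The converse of \<open>smooth_on_coords\<close>.
\<close>

lemma vfieldsI:
  assumes "\<And>m. m \<in> points A \<Longrightarrow> W m \<in> tangent_space A m" "\<And>m. m \<notin> points A \<Longrightarrow> W m = (\<lambda>_. 0)"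
    and "\<And>U \<phi>. (U, \<phi>) \<in> A \<Longrightarrow>
      smooth_on (\<phi> ` U) (\<lambda>x. coords A (U, \<phi>) (inv_into U \<phi> x) (W (inv_into U \<phi> x)))"
  shows "W \<in> vfields A"
proof -
  have "(\<lambda>m. W m f) \<in> smooth_funs A" if f: "f \<in> smooth_funs A" for f
    unfolding smooth_funs_def
  proof clarify
    fix U \<phi> assume U: "(U, \<phi>) \<in> A"
    show "smooth_on (\<phi> ` U) ((\<lambda>m. W m f) \<circ> inv_into U \<phi>)"
    proof (rule smooth_on_cong[OF chart_open[OF U]])
      show "smooth_on (\<phi> ` U) (\<lambda>x. frechet_derivative (f \<circ> inv_into U \<phi>) (at x)
          (coords A (U, \<phi>) (inv_into U \<phi> x) (W (inv_into U \<phi> x))))"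
        by (intro smooth_on_directional_derivative chart_open[OF U] smooth_funs_chart[OF f U]
          assms(3)[OF U])
      fix x assume "x \<in> \<phi> ` U"
      note x = chart_at_open[OF U this]
      show "frechet_derivative (f \<circ> inv_into U \<phi>) (at x)
          (coords A (U, \<phi>) (inv_into U \<phi> x) (W (inv_into U \<phi> x))) = ((\<lambda>m. W m f) \<circ> inv_into U \<phi>) x"
        using coord_vec_coords[OF U x(1) assms(1)[OF x(3)]] x(2) f by (metis comp_apply coord_vec_apply)
    qed
  qed
  then show ?thesis using assms(1,2) by (simp add: vfields_def)
qed

lemma vf_add_vfields: "X \<in> vfields A \<Longrightarrow> Y \<in> vfields A \<Longrightarrow> vf_add X Y \<in> vfields A"
  using tangent_lin[of _ _ _ 1 1] by (auto simp: vfields_def vf_add_def smooth_funs_add)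

lemma vf_zero_vfields: "vf_zero \<in> vfields A"
  by (auto simp: vfields_def vf_zero_def tangent_zero smooth_funs_const)

lemma vf_scale_vfields: "h \<in> smooth_funs A \<Longrightarrow> X \<in> vfields A \<Longrightarrow> vf_scale h X \<in> vfields A"
  using tangent_lin[of _ _ _ _ 0] by (auto simp: vfields_def vf_scale_def smooth_funs_mult)

lemma vfields_extend:
  assumes U: "(U, \<phi>) \<in> A" and c: "cutoff A U c" and u: "smooth_on (\<phi> ` U) (u \<circ> inv_into U \<phi>)"
  shows "(\<lambda>p f. if p \<in> U then c p * coord_vec A (U, \<phi>) p (u p) f else 0) \<in> vfields A" (is "?W \<in> _")
proof -
  have "?W p \<in> tangent_space A p" if "p \<in> points A" for p
    using tangent_lin[OF coord_vec_tangent[OF U] coord_vec_tangent[OF U], of p "c p" "u p" 0 "u p"]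
      tangent_zero[OF that] by (cases "p \<in> U") auto
  moreover have "?W p = (\<lambda>_. 0)" if "p \<notin> points A" for p
    using that pointsI[OF U, of p] by (cases "p \<in> U") auto
  moreover have "(\<lambda>p. ?W p f) \<in> smooth_funs A" if f: "f \<in> smooth_funs A" for f
  proof (rule extend_smooth[OF U c])
    have "smooth_on (\<phi> ` U) (\<lambda>x. frechet_derivative (f \<circ> inv_into U \<phi>) (at x) ((u \<circ> inv_into U \<phi>) x))"
      by (intro smooth_on_directional_derivative chart_open[OF U] smooth_funs_chart[OF f U] u)
    then show "smooth_on (\<phi> ` U) ((\<lambda>p. coord_vec A (U, \<phi>) p (u p) f) \<circ> inv_into U \<phi>)"
      by (rule smooth_on_cong[OF chart_open[OF U], rotated])
        (use U f in \<open>auto simp: coord_vec_apply\<close>)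
  qed
  ultimately show ?thesis by (simp add: vfields_def)
qed

text \<open>
  Coordinate vector fields multiplied by a bump function.
\<close>

lemma local_frame:
  assumes U: "(U, \<phi>) \<in> A" "m \<in> U"
  obtains E N where "\<And>u. E u \<in> vfields A" "open N" "\<phi> m \<in> N" "N \<subseteq> \<phi> ` U"
    "\<And>x u. x \<in> N \<Longrightarrow> E u (inv_into U \<phi> x) = coord_vec A (U, \<phi>) (inv_into U \<phi> x) u"
proof -
  obtain c N where c: "cutoff A U c" and N: "open N" "\<phi> m \<in> N" "N \<subseteq> \<phi> ` U"
    "\<And>x. x \<in> N \<Longrightarrow> c (inv_into U \<phi> x) = 1" using bumpE[OF U] by metis
  show ?thesis
    by (rule that[OF vfields_extend[OF U(1) c] N(1-3), of "\<lambda>u _. u"])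
      (use N chart_at_open[OF U(1)] in \<open>auto simp: o_def smooth_on_const\<close>)
qed

lemma vector_extend:
  assumes "v \<in> tangent_space A m"
  obtains X where "X \<in> vfields A" "X m = v"
proof -
  obtain U \<phi> where U: "(U, \<phi>) \<in> A" "m \<in> U" using assms tangent_point pointsE by metis
  obtain u where u: "v = coord_vec A (U, \<phi>) m u" using assms tangent_space_chart[OF U] by auto
  obtain E N where E: "\<And>u. E u \<in> vfields A" "\<phi> m \<in> N"
    "\<And>x u. x \<in> N \<Longrightarrow> E u (inv_into U \<phi> x) = coord_vec A (U, \<phi>) (inv_into U \<phi> x) u"
    using local_frame[OF U] by metis
  show ?thesis
    by (rule that[OF E(1)[of u]]) (use E(3)[OF E(2)] U u in auto)
qed

text \<open>
  A functional that is linear over smooth functions at \<open>m\<close> depends only on the value of the field at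
  \<open>m\<close>. With a bump function \<open>c\<close> at \<open>m\<close> and \<open>Z = \<Sum> Z\<^sup>b \<partial>\<^sub>b\<close> on the chart domain, the identity
  \<open>c\<^sup>2 Z = \<Sum> (c Z\<^sup>b) (c \<partial>\<^sub>b)\<close> holds globally with smooth coefficients and global fields, so
  \<open>T Z = \<Sum> Z\<^sup>b(m) T(c \<partial>\<^sub>b)\<close>.
\<close>

lemma tensorial_pointwise:
  fixes T :: "'a vfield \<Rightarrow> real"
  assumes m: "m \<in> points A"
    and add: "\<And>X Y. X \<in> vfields A \<Longrightarrow> Y \<in> vfields A \<Longrightarrow> T (vf_add X Y) = T X + T Y"
    and scale: "\<And>h X. h \<in> smooth_funs A \<Longrightarrow> X \<in> vfields A \<Longrightarrow> T (vf_scale h X) = h m * T X"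
    and XY: "X \<in> vfields A" "Y \<in> vfields A" "X m = Y m"
  shows "T X = T Y"
proof -
  obtain U \<phi> where U: "(U, \<phi>) \<in> A" "m \<in> U" using m by (rule pointsE)
  obtain c where c: "cutoff A U c" "c m = 1" using bumpE[OF U] by metis
  define E where "E b = (\<lambda>p f. if p \<in> U then c p * coord_vec A (U, \<phi>) p b f else 0)" for b
  have E: "E b \<in> vfields A" for b
    using vfields_extend[OF U(1) c(1), of "\<lambda>_. b"] by (simp add: E_def o_def smooth_on_const)
  \<comment> \<open>The right-hand side involves \<open>Z\<close> only through \<open>Z m\<close>.\<close>
  have "T Z = (\<Sum>b\<in>Basis. (coords A (U, \<phi>) m (Z m) \<bullet> b) * T (E b))" if Z: "Z \<in> vfields A" for Z
  proof -
    define k where "k b p = (if p \<in> U then c p * (coords A (U, \<phi>) p (Z p) \<bullet> b) else 0)" for b p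
    have k: "k b \<in> smooth_funs A" for b
      unfolding k_def
      by (rule extend_smooth[OF U(1) c(1)])
        (use smooth_on_linear[OF bounded_linear_inner_left chart_open[OF U(1)]
          smooth_on_coords[OF U(1) Z]] in \<open>simp add: o_def\<close>)
    let ?S = "\<lambda>B p f. \<Sum>b\<in>B. k b p * E b p f"
    \<comment> \<open>Membership is carried along because additivity of \<open>T\<close> is assumed for vector fields only.\<close>
    have S: "?S B \<in> vfields A \<and> T (?S B) = (\<Sum>b\<in>B. k b m * T (E b))" if "finite B" for B
      using that
    proof induction
      case empty
      have "T vf_zero = 0"
        using scale[OF smooth_funs_const[of 0] vf_zero_vfields] by (simp add: vf_scale_def vf_zero_def)
      then show ?case using vf_zero_vfields by (simp add: vf_zero_def)
    next
      case (insert b B)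
      have "?S (insert b B) = vf_add (vf_scale (k b) (E b)) (?S B)"
        using insert by (simp add: vf_add_def vf_scale_def)
      then show ?case
        using insert add[OF vf_scale_vfields[OF k E]] scale[OF k E]
          vf_add_vfields[OF vf_scale_vfields[OF k E]] by simp
    qed
    have "vf_scale (\<lambda>p. c p * c p) Z p f = ?S Basis p f" for p f
    proof (cases "p \<in> U")
      case True
      have Zp: "Z p \<in> tangent_space A p" using vfields_tangent[OF Z] pointsI[OF U(1) True] by simp
      have "Z p f = (\<Sum>b\<in>Basis. (coords A (U, \<phi>) p (Z p) \<bullet> b) * coord_vec A (U, \<phi>) p b f)"
      proof (cases "f \<in> smooth_funs A")
        case f: True
        have "frechet_derivative (f \<circ> inv_into U \<phi>) (at (\<phi> p)) u
            = (\<Sum>b\<in>Basis. (u \<bullet> b) * frechet_derivative (f \<circ> inv_into U \<phi>) (at (\<phi> p)) b)" for u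
          using frechet_derivative_in_basis[OF differentiableI[OF smooth_fun_has_derivative[OF f U(1) True]], of u]
          by simp
        from this[of "coords A (U, \<phi>) p (Z p)"] show ?thesis
          using fun_cong[OF coord_vec_coords[OF U(1) True Zp], of f] f by (simp add: coord_vec_apply)
      next
        case False
        then show ?thesis using tangent_nonsmooth[OF Zp] by (simp add: coord_vec_def)
      qed
      then show ?thesis using True
        by (simp add: vf_scale_def k_def E_def sum_distrib_left algebra_simps)
    next
      case False
      then have "c p * Z p f = 0"
        using cutoff_zero[OF c(1)] Z by (cases "p \<in> points A") (auto simp: vfields_def)
      then show ?thesis using False by (simp add: vf_scale_def E_def)
    qed
    then have "vf_scale (\<lambda>p. c p * c p) Z = ?S Basis" by blast
    moreover have "T (vf_scale (\<lambda>p. c p * c p) Z) = T Z"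
      using scale[OF smooth_funs_mult Z] c by (simp add: cutoff_def)
    ultimately show ?thesis using S[OF finite_Basis] U c(2) by (simp add: k_def)
  qed
  then show ?thesis using XY by simp
qed

section \<open>1-forms and the dual connection\<close>

lemma forms1_cotangent: "\<alpha> \<in> forms1 A \<Longrightarrow> m \<in> points A \<Longrightarrow> \<alpha> m \<in> cotangent_space A m"
  by (simp add: forms1_def)

lemma forms1_smooth: "\<alpha> \<in> forms1 A \<Longrightarrow> Y \<in> vfields A \<Longrightarrow> (\<lambda>m. \<alpha> m (Y m)) \<in> smooth_funs A"
  by (simp add: forms1_def)

lemma cotangent_lin:
  "\<zeta> \<in> cotangent_space A m \<Longrightarrow> v \<in> tangent_space A m \<Longrightarrow> w \<in> tangent_space A m \<Longrightarrow>
    \<zeta> (\<lambda>f. a * v f + b * w f) = a * \<zeta> v + b * \<zeta> w"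
  by (simp add: cotangent_space_def)

lemma cotangent_add:
  "\<zeta> \<in> cotangent_space A m \<Longrightarrow> v \<in> tangent_space A m \<Longrightarrow> w \<in> tangent_space A m \<Longrightarrow>
    \<zeta> (\<lambda>f. v f + w f) = \<zeta> v + \<zeta> w"
  using cotangent_lin[of \<zeta> m v w 1 1] by simp

lemma cotangent_scale:
  "\<zeta> \<in> cotangent_space A m \<Longrightarrow> v \<in> tangent_space A m \<Longrightarrow> \<zeta> (\<lambda>f. a * v f) = a * \<zeta> v"
  using cotangent_lin[of \<zeta> m v v a 0] by simp

lemma cotangent_zero:
  "\<zeta> \<in> cotangent_space A m \<Longrightarrow> m \<in> points A \<Longrightarrow> \<zeta> (\<lambda>_. 0) = 0"
  using cotangent_scale[OF _ tangent_zero, of \<zeta> m 0] by simp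

lemma covec_cotangent: "(U, \<phi>) \<in> A \<Longrightarrow> m \<in> U \<Longrightarrow> covec A (U, \<phi>) m q \<in> cotangent_space A m"
  by (auto simp: cotangent_space_def covec_def tangent_lin coords_lin inner_simps)

lemma covec_coord_vec [simp]:
  "(U, \<phi>) \<in> A \<Longrightarrow> m \<in> U \<Longrightarrow> covec A (U, \<phi>) m q (coord_vec A (U, \<phi>) m u) = q \<bullet> u"
  by (simp add: covec_def coord_vec_tangent)

lemma cotangent_coord_vec:
  assumes U: "(U, \<phi>) \<in> A" "m \<in> U" and \<zeta>: "\<zeta> \<in> cotangent_space A m"
  shows "\<zeta> (coord_vec A (U, \<phi>) m u) = (\<Sum>b\<in>Basis. \<zeta> (coord_vec A (U, \<phi>) m b) *\<^sub>R b) \<bullet> u"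
proof -
  interpret linear "\<lambda>u. \<zeta> (coord_vec A (U, \<phi>) m u)"
  proof
    show "\<zeta> (coord_vec A (U, \<phi>) m (x + y)) = \<zeta> (coord_vec A (U, \<phi>) m x) + \<zeta> (coord_vec A (U, \<phi>) m y)" for x y
      using coord_vec_lin[OF U, of 1 x 1 y] cotangent_add[OF \<zeta> coord_vec_tangent[OF U] coord_vec_tangent[OF U]] by simp
    show "\<zeta> (coord_vec A (U, \<phi>) m (r *\<^sub>R x)) = r *\<^sub>R \<zeta> (coord_vec A (U, \<phi>) m x)" for r x
      using coord_vec_lin[OF U, of r x 0 x] cotangent_scale[OF \<zeta> coord_vec_tangent[OF U]] by simp
  qed
  have "(\<Sum>b\<in>Basis. (u \<bullet> b) * \<zeta> (coord_vec A (U, \<phi>) m b)) = \<zeta> (coord_vec A (U, \<phi>) m u)"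
    using sum[of "\<lambda>b. (u \<bullet> b) *\<^sub>R b" Basis] by (simp add: scale euclidean_representation)
  then show ?thesis by (simp add: inner_sum_left inner_commute[of u] mult.commute)
qed

lemma covec_repr:
  assumes "(U, \<phi>) \<in> A" "m \<in> U" "\<zeta> \<in> cotangent_space A m"
  shows "covec A (U, \<phi>) m (\<Sum>b\<in>Basis. \<zeta> (coord_vec A (U, \<phi>) m b) *\<^sub>R b) = \<zeta>"
proof
  fix v
  show "covec A (U, \<phi>) m (\<Sum>b\<in>Basis. \<zeta> (coord_vec A (U, \<phi>) m b) *\<^sub>R b) v = \<zeta> v"
    using cotangent_coord_vec[OF assms, of "coords A (U, \<phi>) m v"] coord_vec_coords[OF assms(1,2)] assms(3)
    by (auto simp: covec_def cotangent_space_def)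
qed

lemma covector_extend:
  assumes m: "m \<in> points A" and \<eta>: "\<eta> \<in> cotangent_space A m"
  obtains \<alpha> where "\<alpha> \<in> forms1 A" "\<alpha> m = \<eta>"
proof -
  obtain U \<phi> where U: "(U, \<phi>) \<in> A" "m \<in> U" using m by (rule pointsE)
  obtain c where c: "cutoff A U c" "c m = 1" using bumpE[OF U] by metis
  define q where "q = (\<Sum>b\<in>Basis. \<eta> (coord_vec A (U, \<phi>) m b) *\<^sub>R b)"
  define \<alpha> where "\<alpha> p = (\<lambda>v. if p \<in> U then c p * covec A (U, \<phi>) p q v else 0)" for p
  have "\<alpha> p \<in> cotangent_space A p" for p
    using covec_cotangent[OF U(1), of p q] by (auto simp: \<alpha>_def cotangent_space_def algebra_simps)
  moreover have "\<alpha> p = (\<lambda>_. 0)" if "p \<notin> points A" for p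
    using that pointsI[OF U(1), of p] by (cases "p \<in> U") (auto simp: \<alpha>_def)
  moreover have "(\<lambda>p. \<alpha> p (Y p)) \<in> smooth_funs A" if Y: "Y \<in> vfields A" for Y
    unfolding \<alpha>_def
  proof (rule extend_smooth[OF U(1) c(1)])
    show "smooth_on (\<phi> ` U) ((\<lambda>p. covec A (U, \<phi>) p q (Y p)) \<circ> inv_into U \<phi>)"
      by (rule smooth_on_cong[OF chart_open[OF U(1)] _ smooth_on_linear[OF bounded_linear_inner_right
              chart_open[OF U(1)] smooth_on_coords[OF U(1) Y]]])
        (use U vfields_tangent[OF Y] pointsI[OF U(1)] in \<open>auto simp: covec_def\<close>)
  qed
  ultimately have "\<alpha> \<in> forms1 A" by (simp add: forms1_def)
  moreover have "\<alpha> m = \<eta>"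
    using covec_repr[OF U \<eta>] U c by (simp add: \<alpha>_def q_def)
  ultimately show ?thesis by (rule that)
qed

lemma forms1_eqI:
  assumes "\<alpha> \<in> forms1 A" "\<beta> \<in> forms1 A"
    and "\<And>Y m. Y \<in> vfields A \<Longrightarrow> m \<in> points A \<Longrightarrow> \<alpha> m (Y m) = \<beta> m (Y m)"
  shows "\<alpha> = \<beta>"
proof (intro ext)
  fix m v
  consider "m \<notin> points A" | "m \<in> points A" "v \<notin> tangent_space A m" | "m \<in> points A" "v \<in> tangent_space A m"
    by blast
  then show "\<alpha> m v = \<beta> m v"
  proof cases
    case 1
    then show ?thesis using assms(1,2) by (simp add: forms1_def)
  next
    case 2
    then show ?thesis using assms(1,2) by (simp add: forms1_def cotangent_space_def)
  next
    case 3
    obtain Y where "Y \<in> vfields A" "Y m = v" using 3(2) by (rule vector_extend)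
    then show ?thesis using assms(3) 3(1) by blast
  qed
qed

text \<open>
  The value of the form on a tangent vector is defined by extending the vector to a field;
  \<open>tensorial_pointwise\<close> makes this independent of the extension.
\<close>

lemma form_of_tensor:
  fixes T :: "'a vfield \<Rightarrow> 'a \<Rightarrow> real"
  assumes smooth: "\<And>Y. Y \<in> vfields A \<Longrightarrow> T Y \<in> smooth_funs A"
    and add: "\<And>X Y m. X \<in> vfields A \<Longrightarrow> Y \<in> vfields A \<Longrightarrow> m \<in> points A \<Longrightarrow>
      T (vf_add X Y) m = T X m + T Y m"
    and scale: "\<And>h X m. h \<in> smooth_funs A \<Longrightarrow> X \<in> vfields A \<Longrightarrow> m \<in> points A \<Longrightarrow>
      T (vf_scale h X) m = h m * T X m"
  obtains \<beta> where "\<beta> \<in> forms1 A" "\<And>Y m. Y \<in> vfields A \<Longrightarrow> m \<in> points A \<Longrightarrow> \<beta> m (Y m) = T Y m"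
proof -
  define ext where "ext m v = (SOME Y. Y \<in> vfields A \<and> Y m = v)" for m v
  have ext: "ext m v \<in> vfields A" "ext m v m = v" if "v \<in> tangent_space A m" for m v
    using someI_ex[of "\<lambda>Y. Y \<in> vfields A \<and> Y m = v"] vector_extend[OF that]
    unfolding ext_def by metis+
  define \<beta> where "\<beta> m v = (if m \<in> points A \<and> v \<in> tangent_space A m then T (ext m v) m else 0)" for m v
  have eq: "\<beta> m (Y m) = T Y m" if Y: "Y \<in> vfields A" and m: "m \<in> points A" for Y m
  proof -
    note Ym = vfields_tangent[OF Y m]
    have "T (ext m (Y m)) m = T Y m"
      by (rule tensorial_pointwise[OF m, of "\<lambda>Y. T Y m"])
        (use add scale m ext[OF Ym] Y in auto)
    then show ?thesis using m Ym by (simp add: \<beta>_def)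
  qed
  have "\<beta> m \<in> cotangent_space A m" if m: "m \<in> points A" for m
  proof -
    have "\<beta> m (\<lambda>f. a * v f + b * w f) = a * \<beta> m v + b * \<beta> m w"
      if v: "v \<in> tangent_space A m" and w: "w \<in> tangent_space A m" for v w a b
    proof -
      let ?a = "vf_scale (\<lambda>_. a) (ext m v)" and ?b = "vf_scale (\<lambda>_. b) (ext m w)"
      have ab: "?a \<in> vfields A" "?b \<in> vfields A"
        by (intro vf_scale_vfields smooth_funs_const ext v w)+
      have "\<beta> m (vf_add ?a ?b m) = T ?a m + T ?b m"
        using eq[OF vf_add_vfields[OF ab] m] add[OF ab m] by simp
      also have "\<dots> = a * T (ext m v) m + b * T (ext m w) m"
        using scale[OF smooth_funs_const ext(1)[OF v] m] scale[OF smooth_funs_const ext(1)[OF w] m] by simp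
      finally show ?thesis
        using v w m ext(2) by (simp add: vf_add_def vf_scale_def \<beta>_def)
    qed
    then show ?thesis by (auto simp: cotangent_space_def \<beta>_def)
  qed
  moreover have "\<beta> m = (\<lambda>_. 0)" if "m \<notin> points A" for m
    using that by (auto simp: \<beta>_def)
  moreover have "(\<lambda>m. \<beta> m (Y m)) \<in> smooth_funs A" if "Y \<in> vfields A" for Y
    using smooth_funs_cong[OF smooth[OF that]] eq[OF that] by metis
  ultimately have "\<beta> \<in> forms1 A" by (simp add: forms1_def)
  then show ?thesis using eq that by blast
qed

lemma connectionD:
  assumes "connection A nab"
  shows "X \<in> vfields A \<Longrightarrow> Y \<in> vfields A \<Longrightarrow> nab X Y \<in> vfields A"
    "X \<in> vfields A \<Longrightarrow> X' \<in> vfields A \<Longrightarrow> Y \<in> vfields A \<Longrightarrow>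
       nab (vf_add X X') Y = vf_add (nab X Y) (nab X' Y)"
    "X \<in> vfields A \<Longrightarrow> Y \<in> vfields A \<Longrightarrow> Y' \<in> vfields A \<Longrightarrow>
       nab X (vf_add Y Y') = vf_add (nab X Y) (nab X Y')"
    "h \<in> smooth_funs A \<Longrightarrow> X \<in> vfields A \<Longrightarrow> Y \<in> vfields A \<Longrightarrow> nab (vf_scale h X) Y = vf_scale h (nab X Y)"
    "h \<in> smooth_funs A \<Longrightarrow> X \<in> vfields A \<Longrightarrow> Y \<in> vfields A \<Longrightarrow>
       nab X (vf_scale h Y) = vf_add (vf_scale (\<lambda>m. X m h) Y) (vf_scale h (nab X Y))"
  using assms unfolding connection_def by blast+

lemma form_add: 
  "\<alpha> \<in> forms1 A \<Longrightarrow> X \<in> vfields A \<Longrightarrow> Y \<in> vfields A \<Longrightarrow> m \<in> points A \<Longrightarrow>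
    \<alpha> m (vf_add X Y m) = \<alpha> m (X m) + \<alpha> m (Y m)"
  using cotangent_add[OF forms1_cotangent] vfields_tangent by (simp add: vf_add_def)

lemma form_scale: 
  "\<alpha> \<in> forms1 A \<Longrightarrow> X \<in> vfields A \<Longrightarrow> m \<in> points A \<Longrightarrow> \<alpha> m (vf_scale h X m) = h m * \<alpha> m (X m)"
  using cotangent_scale[OF forms1_cotangent] vfields_tangent by (simp add: vf_scale_def)

text \<open>
  The definite description of the dual connection is meaningful: \<open>X(\<alpha>(Y)) - \<alpha>(\<nabla>\<^sub>X Y)\<close> is tensorial in
  \<open>Y\<close>, because the derivative of the factor \<open>h\<close> produced by the Leibniz rule for \<open>X\<close> cancels against
  the one in \<open>\<nabla>\<^sub>X (h Y)\<close>.
\<close>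

lemma nabla_form:
  assumes nab: "connection A nab" and X: "X \<in> vfields A" and \<alpha>: "\<alpha> \<in> forms1 A"
  shows "nabla_form A nab X \<alpha> \<in> forms1 A"
    and "Y \<in> vfields A \<Longrightarrow> m \<in> points A \<Longrightarrow>
      nabla_form A nab X \<alpha> m (Y m) = X m (\<lambda>p. \<alpha> p (Y p)) - \<alpha> m (nab X Y m)"
proof -
  note con = connectionD[OF nab]
  define T where "T Y m = X m (\<lambda>p. \<alpha> p (Y p)) - \<alpha> m (nab X Y m)" for Y m
  obtain \<beta> where \<beta>: "\<beta> \<in> forms1 A" "\<And>Y m. Y \<in> vfields A \<Longrightarrow> m \<in> points A \<Longrightarrow> \<beta> m (Y m) = T Y m"
  proof (rule form_of_tensor[of T])
    show "T Y \<in> smooth_funs A" if Y: "Y \<in> vfields A" for Y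
      using smooth_funs_diff[OF vfields_smooth[OF X forms1_smooth[OF \<alpha> Y]] forms1_smooth[OF \<alpha> con(1)[OF X Y]]]
      by (simp add: T_def[abs_def])
    fix m assume m: "m \<in> points A"
    note Xm = vfields_tangent[OF X m]
    show "T (vf_add Y Z) m = T Y m + T Z m" if Y: "Y \<in> vfields A" and Z: "Z \<in> vfields A" for Y Z
    proof -
      have "X m (\<lambda>p. \<alpha> p (vf_add Y Z p)) = X m (\<lambda>p. \<alpha> p (Y p) + \<alpha> p (Z p))"
        by (rule tangent_derivation(4)[OF Xm forms1_smooth[OF \<alpha> vf_add_vfields[OF Y Z]]])
          (rule form_add[OF \<alpha> Y Z])
      then show ?thesis
        using tangent_derivation(1)[OF Xm forms1_smooth[OF \<alpha> Y] forms1_smooth[OF \<alpha> Z]]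
          form_add[OF \<alpha> con(1)[OF X Y] con(1)[OF X Z] m] by (simp add: T_def con(3)[OF X Y Z])
    qed
    show "T (vf_scale h Y) m = h m * T Y m" if h: "h \<in> smooth_funs A" and Y: "Y \<in> vfields A" for h Y
    proof -
      have "X m (\<lambda>p. \<alpha> p (vf_scale h Y p)) = X m (\<lambda>p. h p * \<alpha> p (Y p))"
        by (rule tangent_derivation(4)[OF Xm forms1_smooth[OF \<alpha> vf_scale_vfields[OF h Y]]])
          (rule form_scale[OF \<alpha> Y])
      then show ?thesis
        using tangent_derivation(2)[OF Xm h forms1_smooth[OF \<alpha> Y]]
          form_add[OF \<alpha> vf_scale_vfields[OF vfields_smooth[OF X h] Y]
            vf_scale_vfields[OF h con(1)[OF X Y]] m]
          form_scale[OF \<alpha> Y m] form_scale[OF \<alpha> con(1)[OF X Y] m]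
        by (simp add: T_def con(5)[OF h X Y] algebra_simps)
    qed
  qed blast
  have "nabla_form A nab X \<alpha> \<in> forms1 A \<and> (\<forall>Y\<in>vfields A. \<forall>m\<in>points A.
      nabla_form A nab X \<alpha> m (Y m) = X m (\<lambda>p. \<alpha> p (Y p)) - \<alpha> m (nab X Y m))"
    unfolding nabla_form_def
  proof (rule theI[of _ \<beta>])
    show "\<beta> \<in> forms1 A \<and> (\<forall>Y\<in>vfields A. \<forall>m\<in>points A.
        \<beta> m (Y m) = X m (\<lambda>p. \<alpha> p (Y p)) - \<alpha> m (nab X Y m))"
      using \<beta> unfolding T_def by blast
    fix \<gamma>
    assume \<gamma>: "\<gamma> \<in> forms1 A \<and> (\<forall>Y\<in>vfields A. \<forall>m\<in>points A.
        \<gamma> m (Y m) = X m (\<lambda>p. \<alpha> p (Y p)) - \<alpha> m (nab X Y m))"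
    show "\<gamma> = \<beta>"
    proof (rule forms1_eqI)
      fix Y m assume "Y \<in> vfields A" "m \<in> points A"
      then show "\<gamma> m (Y m) = \<beta> m (Y m)" using \<gamma> \<beta>(2) unfolding T_def by metis
    qed (use \<gamma> \<beta>(1) in auto)
  qed
  then show "nabla_form A nab X \<alpha> \<in> forms1 A"
    "Y \<in> vfields A \<Longrightarrow> m \<in> points A \<Longrightarrow>
      nabla_form A nab X \<alpha> m (Y m) = X m (\<lambda>p. \<alpha> p (Y p)) - \<alpha> m (nab X Y m)"
    by blast+
qed

end

section \<open>The cotangent bundle as an atlas with bump functions\<close>

text \<open>
  The domain and the coordinate map of the chart of \<open>T\<^sup>*M\<close> over the chart \<open>(U, \<phi>)\<close>.
\<close>

definition cdom :: "('a, 'e::euclidean_space) atlas \<Rightarrow> 'a set \<Rightarrow> 'a cpoint set" where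
  "cdom A U = {(m, \<zeta>). m \<in> U \<and> \<zeta> \<in> cotangent_space A m}"

definition cmap :: "('a, 'e::euclidean_space) atlas \<Rightarrow> 'a set \<Rightarrow> ('a \<Rightarrow> 'e) \<Rightarrow> 'a cpoint \<Rightarrow> 'e \<times> 'e" where
  "cmap A U \<phi> = (\<lambda>(m, \<zeta>). (\<phi> m, \<Sum>b\<in>Basis. \<zeta> (coord_vec A (U, \<phi>) m b) *\<^sub>R b))"

text \<open>
  The function \<open>Y\<^sup>v\<close> on \<open>T\<^sup>*M\<close>, linear on each fibre.
\<close>

definition lin_fun :: "'a vfield \<Rightarrow> 'a cpoint \<Rightarrow> real" where
  "lin_fun Y z = snd z (Y (fst z))"

lemma cotangent_bundle_chart_iff:
  "(W, \<kappa>) \<in> cotangent_bundle A \<longleftrightarrow> (\<exists>U \<phi>. (U, \<phi>) \<in> A \<and> W = cdom A U \<and> \<kappa> = cmap A U \<phi>)"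
  by (auto simp: cotangent_bundle_def cot_chart_def cdom_def cmap_def image_iff Bex_def)

lemma cdom_Int: "cdom A U \<inter> cdom A V = cdom A (U \<inter> V)"
  by (auto simp: cdom_def)

lemma fst_cdom: "z \<in> cdom A U \<Longrightarrow> fst z \<in> U" "z \<in> cdom A U \<Longrightarrow> snd z \<in> cotangent_space A (fst z)"
  by (auto simp: cdom_def)

context bump_atlas
begin

text \<open>
  A 1-form is tested on global fields only, so the coordinate field is replaced near each point by a
  cut-off extension of it.
\<close>

lemma form_coefficient_smooth:
  assumes U: "(U, \<phi>) \<in> A" and \<alpha>: "\<alpha> \<in> forms1 A"
  shows "smooth_on (\<phi> ` U) (\<lambda>x. \<alpha> (inv_into U \<phi> x) (coord_vec A (U, \<phi>) (inv_into U \<phi> x) u))"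
proof (rule smooth_on_local[OF chart_open[OF U]])
  fix y assume y: "y \<in> \<phi> ` U"
  obtain E N where E: "\<And>u. E u \<in> vfields A" and N: "open N" "y \<in> N" "N \<subseteq> \<phi> ` U"
    "\<And>x u. x \<in> N \<Longrightarrow> E u (inv_into U \<phi> x) = coord_vec A (U, \<phi>) (inv_into U \<phi> x) u"
    using local_frame[OF U chart_at_open(1)[OF U y]] chart_at_open(2)[OF U y] by metis
  have "smooth_on N ((\<lambda>m. \<alpha> m (E u m)) \<circ> inv_into U \<phi>)"
    by (rule smooth_on_subset[OF smooth_funs_chart[OF forms1_smooth[OF \<alpha> E] U] N(3)])
  then have "smooth_on N (\<lambda>x. \<alpha> (inv_into U \<phi> x) (coord_vec A (U, \<phi>) (inv_into U \<phi> x) u))"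
    by (rule smooth_on_cong[OF N(1), rotated]) (simp add: N(4))
  then show "\<exists>T. open T \<and> y \<in> T \<and>
      smooth_on T (\<lambda>x. \<alpha> (inv_into U \<phi> x) (coord_vec A (U, \<phi>) (inv_into U \<phi> x) u))"
    using N by blast
qed

lemma connection_pointwise:
  assumes nab: "connection A nab" and X: "X \<in> vfields A" "X' \<in> vfields A" and Y: "Y \<in> vfields A"
    and m: "m \<in> points A" "X m = X' m"
  shows "nab X Y m = nab X' Y m"
proof
  fix f
  have "nab (vf_add Z Z') Y m f = nab Z Y m f + nab Z' Y m f"
    if "Z \<in> vfields A" "Z' \<in> vfields A" for Z Z'
    using connectionD(2)[OF nab that Y] by (simp add: vf_add_def)
  moreover have "nab (vf_scale h Z) Y m f = h m * nab Z Y m f"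
    if "h \<in> smooth_funs A" "Z \<in> vfields A" for h Z
    using connectionD(4)[OF nab that Y] by (simp add: vf_scale_def)
  ultimately show "nab X Y m f = nab X' Y m f"
    using X m(2) by (rule tensorial_pointwise[OF m(1), of "\<lambda>X. nab X Y m f"])
qed

lemma nabla_form_pointwise:
  assumes nab: "connection A nab" and Q: "Q \<in> vfields A" "P \<in> vfields A" and \<theta>: "\<theta> \<in> forms1 A"
    and Y: "Y \<in> vfields A" and m: "m \<in> points A" "Q m = P m"
  shows "nabla_form A nab Q \<theta> m (Y m) = nabla_form A nab P \<theta> m (Y m)"
  using nabla_form(2)[OF nab _ \<theta> Y m(1)] connection_pointwise[OF nab Q Y m] Q m(2) by simp

lemma cmap_covec:
  "(U, \<phi>) \<in> A \<Longrightarrow> m \<in> U \<Longrightarrow> cmap A U \<phi> (m, covec A (U, \<phi>) m q) = (\<phi> m, q)"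
  by (simp add: cmap_def euclidean_representation)

lemma cdom_covec: "(U, \<phi>) \<in> A \<Longrightarrow> m \<in> W \<Longrightarrow> m \<in> U \<Longrightarrow> (m, covec A (U, \<phi>) m q) \<in> cdom A W"
  by (simp add: cdom_def covec_cotangent)

lemma cdom_covecE:
  assumes "(U, \<phi>) \<in> A" "z \<in> cdom A U"
  obtains m q where "m \<in> U" "z = (m, covec A (U, \<phi>) m q)"
  by (rule that[OF fst_cdom(1)[OF assms(2)],
        of "\<Sum>b\<in>Basis. snd z (coord_vec A (U, \<phi>) (fst z) b) *\<^sub>R b"])
    (simp add: covec_repr[OF assms(1) fst_cdom[OF assms(2)]])

lemma cmap_inj: "(U, \<phi>) \<in> A \<Longrightarrow> inj_on (cmap A U \<phi>) (cdom A U)"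
proof (rule inj_onI)
  fix z w assume U: "(U, \<phi>) \<in> A" and zw: "z \<in> cdom A U" "w \<in> cdom A U" "cmap A U \<phi> z = cmap A U \<phi> w"
  obtain m q where z: "m \<in> U" "z = (m, covec A (U, \<phi>) m q)" using U zw(1) by (rule cdom_covecE)
  obtain n r where w: "n \<in> U" "w = (n, covec A (U, \<phi>) n r)" using U zw(2) by (rule cdom_covecE)
  have "\<phi> m = \<phi> n" "q = r" using zw(3) z w by (simp_all add: cmap_covec U)
  moreover from this have "m = n" using chart_inj[OF U] z w by (simp add: inj_on_def)
  ultimately show "z = w" using z w by simp
qed

lemma cmap_image:
  assumes U: "(U, \<phi>) \<in> A" and W: "W \<subseteq> U"
  shows "cmap A U \<phi> ` cdom A W = \<phi> ` W \<times> UNIV"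
proof
  show "cmap A U \<phi> ` cdom A W \<subseteq> \<phi> ` W \<times> UNIV" by (auto simp: cmap_def cdom_def)
  show "\<phi> ` W \<times> UNIV \<subseteq> cmap A U \<phi> ` cdom A W"
  proof clarify
    fix m q assume "m \<in> W"
    then show "(\<phi> m, q) \<in> cmap A U \<phi> ` cdom A W"
      using W cmap_covec[OF U, of m q] cdom_covec[OF U, of m W q] by (metis image_eqI subsetD)
  qed
qed

lemma cmap_inverse:
  assumes U: "(U, \<phi>) \<in> A" and x: "x \<in> \<phi> ` U"
  shows "inv_into (cdom A U) (cmap A U \<phi>) (x, q) = (inv_into U \<phi> x, covec A (U, \<phi>) (inv_into U \<phi> x) q)"
  using chart_at_open[OF U x] cmap_covec[OF U, of "inv_into U \<phi> x" q]
  by (intro inv_into_f_eq cmap_inj[OF U] cdom_covec[OF U]) auto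

lemma smooth_on_fst:
  fixes f :: "'f::euclidean_space \<Rightarrow> 'g::real_normed_vector"
  assumes "open S" "smooth_on S f"
  shows "smooth_on (S \<times> UNIV) (\<lambda>z. f (fst z))"
  using smooth_on_compose[of "S \<times> UNIV" S fst f] assms
    smooth_on_linear[OF bounded_linear_fst open_Times[OF assms(1) open_UNIV] smooth_on_ident]
  by (auto simp: o_def open_Times)

text \<open>
  In terms of the transition map \<open>\<tau>\<close> of \<open>M\<close> and its inverse \<open>\<sigma>\<close>, the transition map of \<open>T\<^sup>*M\<close> sends
  \<open>(x, q)\<close> to \<open>(\<tau> x, \<Sum>\<^sub>b (q \<bullet> D\<sigma>(\<tau> x) b) b)\<close>.
\<close>

lemma cotangent_transition:
  assumes U: "(U, \<phi>) \<in> A" and V: "(V, \<psi>) \<in> A"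
  shows "smooth_on (\<phi> ` (U \<inter> V) \<times> UNIV) (cmap A V \<psi> \<circ> inv_into (cdom A U) (cmap A U \<phi>))"
proof -
  let ?S = "\<phi> ` (U \<inter> V)" and ?t = "\<psi> \<circ> inv_into U \<phi>" and ?s = "\<phi> \<circ> inv_into V \<psi>"
  let ?D = "\<lambda>b x. frechet_derivative ?s (at (?t x)) b"
  note S = overlap_open[OF U V]
  have SU: "open (?S \<times> UNIV)" by (intro open_Times S open_UNIV)
  have t: "?t ` ?S \<subseteq> \<psi> ` (V \<inter> U)" using U by auto
  have D: "smooth_on ?S (?D b)" for b
    using smooth_on_compose[OF S overlap_open[OF V U] t transition[OF U V]
        smooth_on_frechet_derivative[OF transition[OF V U]]] by (simp add: o_def)
  have "smooth_on (?S \<times> UNIV) (\<lambda>z. (?t (fst z), \<Sum>b\<in>Basis. (snd z \<bullet> ?D b (fst z)) *\<^sub>R b))"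
    by (intro smooth_on_Pair SU smooth_on_fst[OF S transition[OF U V]] smooth_on_sum smooth_on_scaleR
        smooth_on_const smooth_on_inner smooth_on_fst[OF S D]
        smooth_on_linear[OF bounded_linear_snd] smooth_on_ident)
  then show ?thesis
  proof (rule smooth_on_cong[OF SU, rotated])
    fix z :: "'e \<times> 'e" assume "z \<in> ?S \<times> UNIV"
    then obtain m q where z: "m \<in> U" "m \<in> V" "z = (\<phi> m, q)" by auto
    have "covec A (U, \<phi>) m q (coord_vec A (V, \<psi>) m b) = q \<bullet> frechet_derivative ?s (at (\<psi> m)) b" for b
      using coord_vec_change[OF V z(2) U z(1)] U z by simp
    then show "(?t (fst z), \<Sum>b\<in>Basis. (snd z \<bullet> ?D b (fst z)) *\<^sub>R b)
        = (cmap A V \<psi> \<circ> inv_into (cdom A U) (cmap A U \<phi>)) z"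
      using U z by (simp add: cmap_inverse[OF U imageI[OF z(1)]] cmap_def[of A V])
  qed
qed

lemma pullback_smooth:
  assumes f: "f \<in> smooth_funs A"
  shows "f \<circ> fst \<in> smooth_funs (cotangent_bundle A)"
  unfolding smooth_funs_def
proof (clarsimp simp: cotangent_bundle_chart_iff)
  fix U \<phi> assume U: "(U, \<phi>) \<in> A"
  have op: "open (\<phi> ` U \<times> (UNIV :: 'e set))" by (intro open_Times chart_open[OF U] open_UNIV)
  show "smooth_on (cmap A U \<phi> ` cdom A U) (f \<circ> fst \<circ> inv_into (cdom A U) (cmap A U \<phi>))"
    unfolding cmap_image[OF U subset_refl]
    by (rule smooth_on_cong[OF op _ smooth_on_fst[OF chart_open[OF U] smooth_funs_chart[OF f U]]])
      (auto simp: cmap_inverse[OF U imageI])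
qed

text \<open>
  A chart of \<open>T\<^sup>*M\<close> contains whole fibres, so the pullback of a bump function of \<open>M\<close> is a bump
  function.
\<close>

lemma cotangent_bundle_bump_atlas: "bump_atlas (cotangent_bundle A)"
proof
  fix W :: "'a cpoint set" and \<kappa> :: "'a cpoint \<Rightarrow> 'e \<times> 'e"
  assume "(W, \<kappa>) \<in> cotangent_bundle A"
  then obtain U \<phi> where U: "(U, \<phi>) \<in> A" and W: "W = cdom A U" "\<kappa> = cmap A U \<phi>"
    by (auto simp: cotangent_bundle_chart_iff)
  show "inj_on \<kappa> W" using cmap_inj[OF U] W by simp
  show "open (\<kappa> ` W)" using cmap_image[OF U subset_refl] chart_open[OF U] W by (simp add: open_Times)
  {
    fix W' :: "'a cpoint set" and \<kappa>' :: "'a cpoint \<Rightarrow> 'e \<times> 'e"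
    assume "(W', \<kappa>') \<in> cotangent_bundle A"
    then obtain V \<psi> where V: "(V, \<psi>) \<in> A" and W': "W' = cdom A V" "\<kappa>' = cmap A V \<psi>"
      by (auto simp: cotangent_bundle_chart_iff)
    have im: "\<kappa> ` (W \<inter> W') = \<phi> ` (U \<inter> V) \<times> UNIV"
      unfolding W W' cdom_Int by (rule cmap_image[OF U Int_lower1])
    show "open (\<kappa> ` (W \<inter> W'))"
      unfolding im by (intro open_Times overlap_open[OF U V] open_UNIV)
    show "smooth_on (\<kappa> ` (W \<inter> W')) (\<kappa>' \<circ> inv_into W \<kappa>)"
      unfolding im unfolding W W' by (rule cotangent_transition[OF U V])
  }
  fix z assume z: "z \<in> W"
  have m: "fst z \<in> U" using z W fst_cdom by blast
  obtain c N where c: "cutoff A U c" and N: "open N" "\<phi> (fst z) \<in> N" "N \<subseteq> \<phi> ` U"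
    "\<And>x. x \<in> N \<Longrightarrow> c (inv_into U \<phi> x) = 1"
    using bumpE[OF U m] by metis
  have cut: "cutoff (cotangent_bundle A) W (c \<circ> fst)"
    unfolding cutoff_def
  proof (intro conjI)
    show "c \<circ> fst \<in> smooth_funs (cotangent_bundle A)"
      using c by (auto simp: cutoff_def intro: pullback_smooth)
    show "\<forall>(V', \<psi>')\<in>cotangent_bundle A. \<forall>p\<in>V' - W. \<exists>N. open N \<and> \<psi>' p \<in> N \<and> N \<subseteq> \<psi>' ` V' \<and>
        (\<forall>y\<in>N. (c \<circ> fst) (inv_into V' \<psi>' y) = 0)"
    proof clarify
      fix W' :: "'a cpoint set" and \<kappa>' :: "'a cpoint \<Rightarrow> 'e \<times> 'e" and n \<zeta>
      assume "(W', \<kappa>') \<in> cotangent_bundle A" and p: "(n, \<zeta>) \<in> W'" "(n, \<zeta>) \<notin> W"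
      then obtain V \<psi> where V: "(V, \<psi>) \<in> A" and W': "W' = cdom A V" "\<kappa>' = cmap A V \<psi>"
        by (auto simp: cotangent_bundle_chart_iff)
      have "n \<in> V - U" using p W W' by (auto simp: cdom_def)
      then obtain N' where N': "open N'" "\<psi> n \<in> N'" "N' \<subseteq> \<psi> ` V" "\<forall>y\<in>N'. c (inv_into V \<psi> y) = 0"
        using c V unfolding cutoff_def by blast
      show "\<exists>N. open N \<and> \<kappa>' (n, \<zeta>) \<in> N \<and> N \<subseteq> \<kappa>' ` W' \<and> (\<forall>y\<in>N. (c \<circ> fst) (inv_into W' \<kappa>' y) = 0)"
      proof (intro exI conjI ballI)
        show "open (N' \<times> (UNIV :: 'e set))" by (intro open_Times N' open_UNIV)
        show "\<kappa>' (n, \<zeta>) \<in> N' \<times> UNIV" using N' W' by (simp add: cmap_def)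
        show "N' \<times> UNIV \<subseteq> \<kappa>' ` W'"
          unfolding W' cmap_image[OF V subset_refl] using N' by blast
        show "(c \<circ> fst) (inv_into W' \<kappa>' y) = 0" if "y \<in> N' \<times> UNIV" for y
          using that N' W' cmap_inverse[OF V, of "fst y" "snd y"] by auto
      qed
    qed
  qed
  have "open (N \<times> (UNIV :: 'e set))" by (intro open_Times N open_UNIV)
  moreover have "\<kappa> z \<in> N \<times> UNIV" using N(2) W by (simp add: cmap_def split_beta)
  moreover have "N \<times> UNIV \<subseteq> \<kappa> ` W" unfolding W cmap_image[OF U subset_refl] using N by blast
  moreover have "(c \<circ> fst) (inv_into W \<kappa> y) = 1" if "y \<in> N \<times> UNIV" for y
    using that N W cmap_inverse[OF U, of "fst y" "snd y"] by auto
  ultimately have "\<exists>N. open N \<and> \<kappa> z \<in> N \<and> N \<subseteq> \<kappa> ` W \<and>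
      (\<forall>x\<in>N. (c \<circ> fst) (inv_into W \<kappa> x) = 1)"
    by (intro exI[of _ "N \<times> UNIV"] conjI ballI)
  with cut show "\<exists>c. cutoff (cotangent_bundle A) W c \<and>
      (\<exists>N. open N \<and> \<kappa> z \<in> N \<and> N \<subseteq> \<kappa> ` W \<and> (\<forall>x\<in>N. c (inv_into W \<kappa> x) = 1))"
    by (intro exI[of _ "c \<circ> fst"] conjI)
qed

end

section \<open>Tangent vectors of the cotangent bundle\<close>

locale cotangent_connection = bump_atlas A
  for A :: "('a, 'e::euclidean_space) atlas" +
  fixes nab :: "'a vfield \<Rightarrow> 'a vfield \<Rightarrow> 'a vfield"
  assumes nab: "connection A nab"
begin

abbreviation "CB \<equiv> cotangent_bundle A"

sublocale B: bump_atlas "cotangent_bundle A"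
  by (rule cotangent_bundle_bump_atlas)

abbreviation cvec :: "'a set \<Rightarrow> ('a \<Rightarrow> 'e) \<Rightarrow> 'a cpoint \<Rightarrow> 'e \<times> 'e \<Rightarrow> 'a cpoint tvec" where
  "cvec U \<phi> \<equiv> coord_vec CB (cdom A U, cmap A U \<phi>)"

lemma cot_chart_in: "(U, \<phi>) \<in> A \<Longrightarrow> (cdom A U, cmap A U \<phi>) \<in> CB"
  by (auto simp: cotangent_bundle_chart_iff)

lemma cot_pointsE:
  assumes "z \<in> points CB"
  obtains U \<phi> where "(U, \<phi>) \<in> A" "z \<in> cdom A U"
  using assms by (auto simp: points_def cotangent_bundle_chart_iff)

lemma cot_points: "z \<in> points CB \<longleftrightarrow> fst z \<in> points A \<and> snd z \<in> cotangent_space A (fst z)"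
proof
  assume "z \<in> points CB"
  then obtain U \<phi> where "(U, \<phi>) \<in> A" "z \<in> cdom A U" by (rule cot_pointsE)
  then show "fst z \<in> points A \<and> snd z \<in> cotangent_space A (fst z)"
    using fst_cdom pointsI by blast
next
  assume z: "fst z \<in> points A \<and> snd z \<in> cotangent_space A (fst z)"
  then obtain U \<phi> where U: "(U, \<phi>) \<in> A" "fst z \<in> U" by (auto elim: pointsE)
  then have "z \<in> cdom A U" using z by (simp add: cdom_def split_beta)
  then show "z \<in> points CB" by (rule B.pointsI[OF cot_chart_in[OF U(1)]])
qed

lemma cot_pointsD: "z \<in> points CB \<Longrightarrow> fst z \<in> points A" "z \<in> points CB \<Longrightarrow> snd z \<in> cotangent_space A (fst z)"
  by (simp_all add: cot_points)

lemma cotangent_tangentE: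
  assumes "w \<in> tangent_space CB z" "(U, \<phi>) \<in> A" "z \<in> cdom A U"
  obtains u p where "w = cvec U \<phi> z (u, p)"
  using assms(1) B.tangent_space_chart[OF cot_chart_in[OF assms(2)] assms(3)] by auto

text \<open>
  Derivatives of a function on \<open>T\<^sup>*M\<close> are computed from any formula \<open>F\<close> for it in the coordinates
  \<open>(x, q)\<close> that is valid over a neighbourhood of the base point.
\<close>

lemma cvec_of_derivative:
  assumes U: "(U, \<phi>) \<in> A" "z \<in> cdom A U" and f: "f \<in> smooth_funs CB"
    and N: "open N" "\<phi> (fst z) \<in> N" "N \<subseteq> \<phi> ` U"
    and F: "\<And>x q. x \<in> N \<Longrightarrow> f (inv_into U \<phi> x, covec A (U, \<phi>) (inv_into U \<phi> x) q) = F (x, q)"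
    and D: "(F has_derivative D) (at (cmap A U \<phi> z))"
  shows "cvec U \<phi> z u f = D u"
proof -
  have "((f \<circ> inv_into (cdom A U) (cmap A U \<phi>)) has_derivative D) (at (cmap A U \<phi> z))"
  proof (rule has_derivative_transform_within_open[OF D])
    show "open (N \<times> (UNIV :: 'e set))" by (intro open_Times N open_UNIV)
    show "cmap A U \<phi> z \<in> N \<times> UNIV" using N(2) by (simp add: cmap_def split_beta)
    show "F y = (f \<circ> inv_into (cdom A U) (cmap A U \<phi>)) y" if "y \<in> N \<times> UNIV" for y
    proof -
      obtain x q where y: "y = (x, q)" "x \<in> N" using \<open>y \<in> N \<times> UNIV\<close> by auto
      then show ?thesis using F[of x q] N(3) cmap_inverse[OF U(1), of x q] by auto
    qed
  qed
  from frechet_derivative_at[OF this, THEN fun_cong, of u] show ?thesis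
    using f by (simp add: B.coord_vec_apply)
qed

lemma pr_apply: "f \<in> smooth_funs A \<Longrightarrow> pushforward A fst w f = w (f \<circ> fst)"
  by (simp add: pushforward_def)

lemma pr_eq_apply: "pushforward A fst w = v \<Longrightarrow> f \<in> smooth_funs A \<Longrightarrow> w (f \<circ> fst) = v f"
  using pr_apply[of f w] by simp

lemma pr_lin: "pushforward A fst (\<lambda>f. a * v f + b * w f)
    = (\<lambda>f. a * pushforward A fst v f + b * pushforward A fst w f)"
  by (auto simp: pushforward_def)

lemma pr_diff_vertical:
  assumes "pushforward A fst v = x" "pushforward A fst w = (\<lambda>_. 0)"
  shows "pushforward A fst (\<lambda>f. v f - w f) = x"
  using pr_lin[of 1 v "- 1" w] assms by simp

lemma fst_cmap: "fst (cmap A U \<phi> z) = \<phi> (fst z)"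
  by (simp add: cmap_def split_beta)

lemma pr_cvec:
  assumes U: "(U, \<phi>) \<in> A" "z \<in> cdom A U"
  shows "pushforward A fst (cvec U \<phi> z (u, p)) = coord_vec A (U, \<phi>) (fst z) u"
proof
  fix f
  note m = fst_cdom(1)[OF U(2)]
  show "pushforward A fst (cvec U \<phi> z (u, p)) f = coord_vec A (U, \<phi>) (fst z) u f"
  proof (cases "f \<in> smooth_funs A")
    case f: True
    let ?D = "frechet_derivative (f \<circ> inv_into U \<phi>) (at (\<phi> (fst z)))"
    have "((f \<circ> inv_into U \<phi>) \<circ> fst has_derivative ?D \<circ> fst) (at (cmap A U \<phi> z))"
      by (rule diff_chain_at[OF has_derivative_fst[OF has_derivative_ident]])
        (use smooth_fun_has_derivative[OF f U(1) m] in \<open>simp add: fst_cmap\<close>)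
    then have "cvec U \<phi> z (u, p) (f \<circ> fst) = (?D \<circ> fst) (u, p)"
      by (rule cvec_of_derivative[OF U pullback_smooth[OF f] chart_open[OF U(1)] _ subset_refl, rotated 2])
        (use m in auto)
    then show ?thesis using f by (simp add: pr_apply coord_vec_apply)
  qed (simp add: pushforward_def coord_vec_def)
qed

lemma pr_tangent:
  assumes "w \<in> tangent_space CB z"
  shows "pushforward A fst w \<in> tangent_space A (fst z)"
proof -
  obtain U \<phi> where U: "(U, \<phi>) \<in> A" "z \<in> cdom A U"
    using B.tangent_point[OF assms] by (rule cot_pointsE)
  obtain u p where "w = cvec U \<phi> z (u, p)" using assms U by (rule cotangent_tangentE)
  then show ?thesis using pr_cvec[OF U] coord_vec_tangent[OF U(1) fst_cdom(1)[OF U(2)]] by simp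
qed

lemma lin_fun_smooth:
  assumes Y: "Y \<in> vfields A"
  shows "lin_fun Y \<in> smooth_funs CB"
  unfolding smooth_funs_def
proof (clarsimp simp: cotangent_bundle_chart_iff)
  fix U \<phi> assume U: "(U, \<phi>) \<in> A"
  have op: "open (\<phi> ` U \<times> (UNIV :: 'e set))" by (intro open_Times chart_open[OF U] open_UNIV)
  have "smooth_on (\<phi> ` U \<times> UNIV)
      (\<lambda>z. snd z \<bullet> coords A (U, \<phi>) (inv_into U \<phi> (fst z)) (Y (inv_into U \<phi> (fst z))))"
    by (intro smooth_on_inner op smooth_on_linear[OF bounded_linear_snd] smooth_on_ident
        smooth_on_fst[OF chart_open[OF U] smooth_on_coords[OF U Y]])
  then show "smooth_on (cmap A U \<phi> ` cdom A U) (lin_fun Y \<circ> inv_into (cdom A U) (cmap A U \<phi>))"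
    unfolding cmap_image[OF U subset_refl]
  proof (rule smooth_on_cong[OF op, rotated])
    fix z :: "'e \<times> 'e" assume "z \<in> \<phi> ` U \<times> UNIV"
    then obtain x q where z: "z = (x, q)" "x \<in> \<phi> ` U" by auto
    show "snd z \<bullet> coords A (U, \<phi>) (inv_into U \<phi> (fst z)) (Y (inv_into U \<phi> (fst z)))
        = (lin_fun Y \<circ> inv_into (cdom A U) (cmap A U \<phi>)) z"
      using cmap_inverse[OF U z(2), of q] vfields_tangent[OF Y chart_at_open(3)[OF U z(2)]]
      by (simp add: z(1) lin_fun_def covec_def)
  qed
qed

text \<open>
  If \<open>E\<close> is a coordinate field near the base point, then \<open>E\<^sup>v\<close> is there a fibre coordinate of \<open>T\<^sup>*M\<close>.
\<close>

lemma lin_fun_frame: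
  assumes U: "(U, \<phi>) \<in> A" "z \<in> cdom A U" and E: "E \<in> vfields A"
    and N: "open N" "\<phi> (fst z) \<in> N" "N \<subseteq> \<phi> ` U"
    and eq: "\<And>x. x \<in> N \<Longrightarrow> E (inv_into U \<phi> x) = coord_vec A (U, \<phi>) (inv_into U \<phi> x) b"
  shows "cvec U \<phi> z (u, p) (lin_fun E) = p \<bullet> b"
proof -
  have "((\<lambda>y. snd y \<bullet> b) has_derivative (\<lambda>h. snd h \<bullet> b)) (at (cmap A U \<phi> z))"
    by (auto intro!: derivative_eq_intros)
  from cvec_of_derivative[OF U lin_fun_smooth[OF E] N _ this, of "(u, p)"] show ?thesis
    using eq chart_at_open[OF U(1) subsetD[OF N(3)]] U(1) by (simp add: lin_fun_def)
qed

text \<open>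
  A tangent vector of \<open>T\<^sup>*M\<close> is determined by its projection, which gives the coordinates along \<open>M\<close>,
  and by its action on the functions \<open>Y\<^sup>v\<close>, which gives the fibre coordinates by \<open>lin_fun_frame\<close>.
\<close>

lemma cot_tangent_eqI:
  assumes w: "w \<in> tangent_space CB z" "w' \<in> tangent_space CB z"
    and pr: "pushforward A fst w = pushforward A fst w'"
    and lin: "\<And>Y. Y \<in> vfields A \<Longrightarrow> w (lin_fun Y) = w' (lin_fun Y)"
  shows "w = w'"
proof -
  obtain U \<phi> where U: "(U, \<phi>) \<in> A" "z \<in> cdom A U"
    using B.tangent_point[OF w(1)] by (rule cot_pointsE)
  note m = fst_cdom(1)[OF U(2)]
  obtain u p where up: "w = cvec U \<phi> z (u, p)" using w(1) U by (rule cotangent_tangentE)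
  obtain u' p' where up': "w' = cvec U \<phi> z (u', p')" using w(2) U by (rule cotangent_tangentE)
  have "u = u'" using pr coord_vec_inj[OF U(1) m] by (simp add: up up' pr_cvec[OF U])
  moreover have "p = p'"
  proof (rule euclidean_eqI)
    fix b :: 'e
    obtain E N where E: "\<And>u. E u \<in> vfields A" and N: "open N" "\<phi> (fst z) \<in> N" "N \<subseteq> \<phi> ` U"
      "\<And>x u. x \<in> N \<Longrightarrow> E u (inv_into U \<phi> x) = coord_vec A (U, \<phi>) (inv_into U \<phi> x) u"
      using local_frame[OF U(1) m] by blast
    show "p \<bullet> b = p' \<bullet> b"
      using lin[OF E[of b]] lin_fun_frame[OF U E N(1-3) N(4)] by (simp add: up up')
  qed
  ultimately show ?thesis by (simp add: up up')
qed

text \<open>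
  The smooth version of \<open>cot_tangent_eqI\<close>: near each point, every coordinate of \<open>W\<close> is \<open>W\<close> applied to
  the pullback of an extended coordinate of \<open>M\<close> or to \<open>E\<^sup>v\<close> for a local coordinate field \<open>E\<close>.
\<close>

lemma cot_vfieldsI:
  assumes tan: "\<And>z. z \<in> points CB \<Longrightarrow> W z \<in> tangent_space CB z"
    and out: "\<And>z. z \<notin> points CB \<Longrightarrow> W z = (\<lambda>_. 0)"
    and base: "\<And>f. f \<in> smooth_funs A \<Longrightarrow> (\<lambda>z. W z (f \<circ> fst)) \<in> smooth_funs CB"
    and fib: "\<And>Y. Y \<in> vfields A \<Longrightarrow> (\<lambda>z. W z (lin_fun Y)) \<in> smooth_funs CB"
  shows "W \<in> vfields CB"
proof (rule B.vfieldsI[OF tan out])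
  fix V \<kappa> assume "(V, \<kappa>) \<in> CB"
  then obtain U \<phi> where U: "(U, \<phi>) \<in> A" and V: "V = cdom A U" "\<kappa> = cmap A U \<phi>"
    by (auto simp: cotangent_bundle_chart_iff)
  let ?i = "inv_into (cdom A U) (cmap A U \<phi>)"
  let ?c = "\<lambda>y. coords CB (cdom A U, cmap A U \<phi>) (?i y) (W (?i y))"
  have op: "open (\<phi> ` U \<times> (UNIV :: 'e set))" by (intro open_Times chart_open[OF U] open_UNIV)
  note C = cot_chart_in[OF U]
  \<comment> \<open>If differentiating \<open>f\<close> picks out the \<open>b\<close>-coordinate over \<open>N\<close>, that coordinate of \<open>W\<close> is \<open>W f\<close> there.\<close>
  have loc: "\<exists>T. open T \<and> y \<in> T \<and> smooth_on T (\<lambda>y. ?c y \<bullet> b)"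
    if g: "g \<in> smooth_funs CB" and N: "open N" "fst y \<in> N" "N \<subseteq> \<phi> ` U"
      and eq: "\<And>z u p. z \<in> cdom A U \<Longrightarrow> \<phi> (fst z) \<in> N \<Longrightarrow> cvec U \<phi> z (u, p) f = (u, p) \<bullet> b"
      and gf: "g = (\<lambda>z. W z f)" for y g N b f
  proof -
    have op': "open (N \<times> (UNIV :: 'e set))" by (intro open_Times N open_UNIV)
    have "smooth_on (N \<times> UNIV) (g \<circ> ?i)"
      using smooth_on_subset[OF smooth_funs_chart[OF g C], of "N \<times> UNIV"] cmap_image[OF U subset_refl] N(3)
      by auto
    then have "smooth_on (N \<times> UNIV) (\<lambda>y. ?c y \<bullet> b)"
    proof (rule smooth_on_cong[OF op', rotated])
      fix x :: "'e \<times> 'e" assume x: "x \<in> N \<times> UNIV"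
      then have xi: "x \<in> cmap A U \<phi> ` cdom A U"
        using N(3) cmap_image[OF U subset_refl] by (cases x) auto
      note zx = B.chart_at_open[OF C xi]
      have "\<phi> (fst (?i x)) \<in> N" using zx(2) x fst_cmap[of U \<phi> "?i x"] by (cases x) auto
      then show "(g \<circ> ?i) x = ?c x \<bullet> b"
        using eq[OF zx(1), of "fst (?c x)" "snd (?c x)"] B.coord_vec_coords[OF C zx(1) tan[OF zx(3)]]
        by (simp add: gf)
    qed
    then show ?thesis using op' N(2) by (intro exI[of _ "N \<times> UNIV"]) (cases y, auto)
  qed
  show "smooth_on (\<kappa> ` V) (\<lambda>x. coords CB (V, \<kappa>) (inv_into V \<kappa> x) (W (inv_into V \<kappa> x)))"
    unfolding V cmap_image[OF U subset_refl]
  proof (rule smooth_on_components[OF op], rule smooth_on_local[OF op])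
    fix b y :: "'e \<times> 'e" assume b: "b \<in> Basis" and y: "y \<in> \<phi> ` U \<times> UNIV"
    define m where "m = inv_into U \<phi> (fst y)"
    have "fst y \<in> \<phi> ` U" using y by auto
    from chart_at_open[OF U this] have m: "m \<in> U" "\<phi> m = fst y" by (simp_all add: m_def)
    consider i where "b = (i, 0)" | i where "b = (0, i)"
      using b by (auto simp: Basis_prod_def)
    then show "\<exists>T. open T \<and> y \<in> T \<and> smooth_on T (\<lambda>y. ?c y \<bullet> b)"
    proof cases
      case 1
      obtain s N where s: "s \<in> smooth_funs A" and N: "open N" "\<phi> m \<in> N" "N \<subseteq> \<phi> ` U"
        "\<And>x u. x \<in> N \<Longrightarrow> coord_vec A (U, \<phi>) (inv_into U \<phi> x) u s = u \<bullet> i"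
        using coordinate_function[OF U m(1), of i] by blast
      have "cvec U \<phi> z (u, p) (s \<circ> fst) = (u, p) \<bullet> b" if z: "z \<in> cdom A U" "\<phi> (fst z) \<in> N" for z u p
        using N(4)[OF z(2)] fun_cong[OF pr_cvec[OF U z(1), of u p], of s] s U fst_cdom(1)[OF z(1)] 1
        by (simp add: pr_apply)
      from loc[OF base[OF s] N(1) _ N(3) this refl] show ?thesis using N(2) m(2) by simp
    next
      case 2
      obtain E N where E: "\<And>u. E u \<in> vfields A" and N: "open N" "\<phi> m \<in> N" "N \<subseteq> \<phi> ` U"
        "\<And>x u. x \<in> N \<Longrightarrow> E u (inv_into U \<phi> x) = coord_vec A (U, \<phi>) (inv_into U \<phi> x) u"
        using local_frame[OF U m(1)] by blast
      have "cvec U \<phi> z (u, p) (lin_fun (E i)) = (u, p) \<bullet> b"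
        if z: "z \<in> cdom A U" "\<phi> (fst z) \<in> N" for z u p
        using lin_fun_frame[OF U z(1) E N(1) z(2) N(3) N(4)] 2 by simp
      from loc[OF fib[OF E[of i]] N(1) _ N(3) this refl] show ?thesis using N(2) m(2) by simp
    qed
  qed
qed

section \<open>The canonical 1-form\<close>

lemma canonical_form_apply:
  "w \<in> tangent_space CB z \<Longrightarrow> canonical_form A z w = snd z (pushforward A fst w)"
  by (simp add: canonical_form_def B.tangent_point)

text \<open>
  In coordinates \<open>(x, q)\<close> the canonical form is \<open>\<Sum> q\<^sub>b dx\<^sup>b\<close>.
\<close>

lemma canonical_form_forms1: "canonical_form A \<in> forms1 CB"
proof -
  have "canonical_form A z \<in> cotangent_space CB z" if z: "z \<in> points CB" for z
    unfolding cotangent_space_def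
    using cotangent_lin[OF cot_pointsD(2)[OF z] pr_tangent pr_tangent] B.tangent_lin
    by (auto simp: canonical_form_apply pr_lin) (simp add: canonical_form_def)
  moreover have "canonical_form A z = (\<lambda>_. 0)" if "z \<notin> points CB" for z
    using that by (simp add: canonical_form_def)
  moreover have "(\<lambda>z. canonical_form A z (Y z)) \<in> smooth_funs CB" if Y: "Y \<in> vfields CB" for Y
    unfolding smooth_funs_def
  proof (clarsimp simp: cotangent_bundle_chart_iff)
    fix U \<phi> assume U: "(U, \<phi>) \<in> A"
    let ?i = "inv_into (cdom A U) (cmap A U \<phi>)"
    let ?c = "\<lambda>y. coords CB (cdom A U, cmap A U \<phi>) (?i y) (Y (?i y))"
    note C = cot_chart_in[OF U]
    note op = B.chart_open[OF C]
    have "smooth_on (cmap A U \<phi> ` cdom A U) (\<lambda>y. snd y \<bullet> fst (?c y))"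
      by (intro smooth_on_inner op smooth_on_linear[OF bounded_linear_snd] smooth_on_ident
          smooth_on_linear[OF bounded_linear_fst] B.smooth_on_coords[OF C Y])
    then show "smooth_on (cmap A U \<phi> ` cdom A U) ((\<lambda>z. canonical_form A z (Y z)) \<circ> ?i)"
    proof (rule smooth_on_cong[OF op, rotated])
      fix y :: "'e \<times> 'e" assume y: "y \<in> cmap A U \<phi> ` cdom A U"
      note zy = B.chart_at_open[OF C y]
      note Yt = B.vfields_tangent[OF Y zy(3)]
      obtain x q where xq: "y = (x, q)" "x \<in> \<phi> ` U" using y cmap_image[OF U subset_refl] by auto
      have "pushforward A fst (Y (?i y)) = coord_vec A (U, \<phi>) (inv_into U \<phi> x) (fst (?c y))"
        using pr_cvec[OF U zy(1), of "fst (?c y)" "snd (?c y)"] B.coord_vec_coords[OF C zy(1) Yt]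
          cmap_inverse[OF U xq(2), of q] xq(1) by simp
      then show "snd y \<bullet> fst (?c y) = ((\<lambda>z. canonical_form A z (Y z)) \<circ> ?i) y"
        using canonical_form_apply[OF Yt] cmap_inverse[OF U xq(2), of q] xq(1)
          chart_at_open(1)[OF U xq(2)] U by simp
    qed
  qed
  ultimately show ?thesis by (simp add: forms1_def)
qed

section \<open>Vertical lifts\<close>

lemma cvec_zero:
  "(U, \<phi>) \<in> A \<Longrightarrow> m \<in> U \<Longrightarrow> coord_vec A (U, \<phi>) m 0 = (\<lambda>_. 0)"
  using coord_vec_lin[of U \<phi> m 0 0 0 0] by simp

lemma cotangent_space_lin:
  "\<zeta> \<in> cotangent_space A m \<Longrightarrow> \<eta> \<in> cotangent_space A m \<Longrightarrow> (\<lambda>v. \<zeta> v + t * \<eta> v) \<in> cotangent_space A m"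
  by (auto simp: cotangent_space_def algebra_simps)

text \<open>
  The curve \<open>t \<mapsto> (m, \<zeta> + t \<eta>)\<close> is a straight line in the fibre coordinates.
\<close>

lemma vertical_vec_cvec:
  assumes U: "(U, \<phi>) \<in> A" "z \<in> cdom A U" and \<eta>: "\<eta> \<in> cotangent_space A (fst z)"
  shows "vertical_vec A z \<eta> = cvec U \<phi> z (0, \<Sum>b\<in>Basis. \<eta> (coord_vec A (U, \<phi>) (fst z) b) *\<^sub>R b)"
    (is "_ = cvec U \<phi> z (0, ?h)")
proof
  fix f
  show "vertical_vec A z \<eta> f = cvec U \<phi> z (0, ?h) f"
  proof (cases "f \<in> smooth_funs CB")
    case f: True
    note C = cot_chart_in[OF U(1)]
    let ?F = "f \<circ> inv_into (cdom A U) (cmap A U \<phi>)" and ?y = "cmap A U \<phi> z"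
    let ?D = "frechet_derivative ?F (at ?y)"
    \<comment> \<open>\<open>?h\<close> is the vector of components of \<open>\<eta>\<close>.\<close>
    have curve: "f (fst z, \<lambda>v. snd z v + t * \<eta> v) = ?F (?y + t *\<^sub>R (0, ?h))" for t
    proof -
      let ?z = "(fst z, \<lambda>v. snd z v + t * \<eta> v)"
      have mem: "?z \<in> cdom A U"
        using fst_cdom[OF U(2)] cotangent_space_lin[OF _ \<eta>] by (simp add: cdom_def)
      have eq: "cmap A U \<phi> ?z = ?y + t *\<^sub>R (0, ?h)"
        by (simp add: cmap_def split_beta scaleR_add_left sum.distrib scaleR_sum_right)
      show ?thesis using B.chart_inverse[OF C mem] unfolding eq by simp
    qed
    have D: "(?F has_derivative ?D) (at ?y)"
      by (rule B.smooth_fun_has_derivative[OF f C U(2)])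
    interpret D: linear ?D using D by (rule has_derivative_linear)
    have "((\<lambda>t. ?y + t *\<^sub>R (0, ?h)) has_derivative (\<lambda>t. t *\<^sub>R (0, ?h))) (at 0)"
      by (auto intro!: derivative_eq_intros)
    then have "(?F \<circ> (\<lambda>t. ?y + t *\<^sub>R (0, ?h)) has_derivative ?D \<circ> (\<lambda>t. t *\<^sub>R (0, ?h))) (at 0)"
      by (rule diff_chain_at) (use D in \<open>simp add: zero_prod_def[symmetric]\<close>)
    moreover have "?D \<circ> (\<lambda>t. t *\<^sub>R (0, ?h)) = (*) (?D (0, ?h))"
      by (simp only: fun_eq_iff comp_apply D.scale real_scaleR_def mult.commute simp_thms)
    moreover have "?F \<circ> (\<lambda>t. ?y + t *\<^sub>R (0, ?h)) = (\<lambda>t. f (fst z, \<lambda>v. snd z v + t * \<eta> v))"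
      using curve by (simp only: fun_eq_iff comp_apply simp_thms)
    ultimately have "((\<lambda>t. f (fst z, \<lambda>v. snd z v + t * \<eta> v)) has_real_derivative ?D (0, ?h)) (at 0)"
      by (simp only: has_field_derivative_def)
    then show ?thesis
      using f by (simp add: vertical_vec_def B.coord_vec_apply DERIV_imp_deriv)
  qed (simp add: vertical_vec_def coord_vec_def)
qed

lemma vertical_vec:
  assumes z: "z \<in> points CB" and \<eta>: "\<eta> \<in> cotangent_space A (fst z)"
  shows "vertical_vec A z \<eta> \<in> tangent_space CB z"
    and "pushforward A fst (vertical_vec A z \<eta>) = (\<lambda>_. 0)"
    and "Y \<in> vfields A \<Longrightarrow> vertical_vec A z \<eta> (lin_fun Y) = \<eta> (Y (fst z))"
proof -
  obtain U \<phi> where U: "(U, \<phi>) \<in> A" "z \<in> cdom A U" using z by (rule cot_pointsE)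
  show "vertical_vec A z \<eta> \<in> tangent_space CB z"
    unfolding vertical_vec_cvec[OF U \<eta>] by (rule B.coord_vec_tangent[OF cot_chart_in[OF U(1)] U(2)])
  show "pushforward A fst (vertical_vec A z \<eta>) = (\<lambda>_. 0)"
    unfolding vertical_vec_cvec[OF U \<eta>] pr_cvec[OF U] by (rule cvec_zero[OF U(1) fst_cdom(1)[OF U(2)]])
  show "vertical_vec A z \<eta> (lin_fun Y) = \<eta> (Y (fst z))" if Y: "Y \<in> vfields A"
    using lin_fun_smooth[OF Y]
    by (auto simp: vertical_vec_def lin_fun_def intro!: DERIV_imp_deriv derivative_eq_intros)
qed

lemma form_pullback_smooth:
  "(\<lambda>m. \<alpha> m (Y m)) \<in> smooth_funs A \<Longrightarrow> (\<lambda>z. \<alpha> (fst z) (Y (fst z))) \<in> smooth_funs CB"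
  using pullback_smooth[of "\<lambda>m. \<alpha> m (Y m)"] by (simp add: o_def)

text \<open>
  The identity \<open>\<alpha>\<^sup>v Y\<^sup>v = \<alpha>(Y)\<close>, together with verticality.
\<close>

lemma vlift:
  assumes \<alpha>: "\<alpha> \<in> forms1 A" and z: "z \<in> points CB"
  shows "vlift A \<alpha> z \<in> tangent_space CB z"
    and "pushforward A fst (vlift A \<alpha> z) = (\<lambda>_. 0)"
    and "Y \<in> vfields A \<Longrightarrow> vlift A \<alpha> z (lin_fun Y) = \<alpha> (fst z) (Y (fst z))"
  using vertical_vec[OF z forms1_cotangent[OF \<alpha> cot_pointsD(1)[OF z]]] z by (simp_all add: vlift_def)

lemma vlift_vfields:
  assumes \<alpha>: "\<alpha> \<in> forms1 A"
  shows "vlift A \<alpha> \<in> vfields CB"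
proof (rule cot_vfieldsI)
  show "(\<lambda>z. vlift A \<alpha> z (f \<circ> fst)) \<in> smooth_funs CB" if f: "f \<in> smooth_funs A" for f
    by (rule B.smooth_funs_cong[OF B.smooth_funs_const[of 0]])
      (simp add: pr_eq_apply[OF vlift(2)[OF \<alpha>] f])
  show "(\<lambda>z. vlift A \<alpha> z (lin_fun Y)) \<in> smooth_funs CB" if Y: "Y \<in> vfields A" for Y
    by (rule B.smooth_funs_cong[OF form_pullback_smooth[of \<alpha>, OF forms1_smooth[OF \<alpha> Y]]])
      (simp add: vlift(3)[OF \<alpha> _ Y])
qed (erule vlift(1)[OF \<alpha>], simp add: vlift_def)

section \<open>Horizontal lifts\<close>

text \<open>
  A section of \<open>T\<^sup>*M\<close> is smooth as a map: its components are smooth by \<open>form_coefficient_smooth\<close>.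
\<close>

lemma section_chart:
  fixes \<sigma> :: "'a form1"
  assumes U: "(U, \<phi>) \<in> A" and \<sigma>: "\<sigma> \<in> forms1 A"
  defines "S \<equiv> \<lambda>x. cmap A U \<phi> (inv_into U \<phi> x, \<sigma> (inv_into U \<phi> x))"
  shows "smooth_on (\<phi> ` U) S"
    and "x \<in> \<phi> ` U \<Longrightarrow> S x \<in> cmap A U \<phi> ` cdom A U"
    and "x \<in> \<phi> ` U \<Longrightarrow>
      inv_into (cdom A U) (cmap A U \<phi>) (S x) = (inv_into U \<phi> x, \<sigma> (inv_into U \<phi> x))"
proof -
  let ?i = "inv_into U \<phi>"
  have "smooth_on (\<phi> ` U) (\<lambda>x. (x, \<Sum>b\<in>Basis. \<sigma> (?i x) (coord_vec A (U, \<phi>) (?i x) b) *\<^sub>R b))"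
    by (intro smooth_on_Pair smooth_on_sum smooth_on_scaleR smooth_on_const smooth_on_ident
        form_coefficient_smooth U \<sigma> chart_open[OF U])
  then show "smooth_on (\<phi> ` U) S"
    by (rule smooth_on_cong[OF chart_open[OF U], rotated])
      (use chart_at_open(2)[OF U] in \<open>simp add: S_def cmap_def\<close>)
  show "S x \<in> cmap A U \<phi> ` cdom A U"
    "inv_into (cdom A U) (cmap A U \<phi>) (S x) = (?i x, \<sigma> (?i x))" if x: "x \<in> \<phi> ` U"
  proof -
    have "(?i x, \<sigma> (?i x)) \<in> cdom A U"
      using forms1_cotangent[OF \<sigma>] chart_at_open[OF U x] by (simp add: cdom_def)
    then show "S x \<in> cmap A U \<phi> ` cdom A U"
      "inv_into (cdom A U) (cmap A U \<phi>) (S x) = (?i x, \<sigma> (?i x))"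
      unfolding S_def using B.chart_inverse[OF cot_chart_in[OF U]] by auto
  qed
qed

text \<open>
  By the chain rule, the velocity of a section \<open>\<sigma>\<close> in direction \<open>v\<close> is a tangent vector of \<open>T\<^sup>*M\<close>. It
  projects to \<open>v\<close> and satisfies \<open>(\<sigma>\<^sub>* v) Y\<^sup>v = v(\<sigma>(Y))\<close>, because \<open>Y\<^sup>v \<circ> \<sigma> = \<sigma>(Y)\<close>.
\<close>

lemma section_pushforward:
  assumes z: "z \<in> points CB" and \<sigma>: "\<sigma> \<in> forms1 A" "\<sigma> (fst z) = snd z"
    and v: "v \<in> tangent_space A (fst z)"
  shows "pushforward CB (\<lambda>p. (p, \<sigma> p)) v \<in> tangent_space CB z"
    and "pushforward A fst (pushforward CB (\<lambda>p. (p, \<sigma> p)) v) = v"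
    and "Y \<in> vfields A \<Longrightarrow> pushforward CB (\<lambda>p. (p, \<sigma> p)) v (lin_fun Y) = v (\<lambda>p. \<sigma> p (Y p))"
proof -
  let ?s = "\<lambda>p. (p, \<sigma> p)"
  obtain U \<phi> where U: "(U, \<phi>) \<in> A" "z \<in> cdom A U" using z by (rule cot_pointsE)
  note m = fst_cdom(1)[OF U(2)] and C = cot_chart_in[OF U(1)]
  obtain u where u: "v = coord_vec A (U, \<phi>) (fst z) u"
    using v tangent_space_chart[OF U(1) m] by auto
  define S where "S W \<psi> x = cmap A W \<psi> (inv_into W \<psi> x, \<sigma> (inv_into W \<psi> x))" for W \<psi> x
  have S: "smooth_on (\<psi> ` W) (S W \<psi>)"
    "\<And>x. x \<in> \<psi> ` W \<Longrightarrow> S W \<psi> x \<in> cmap A W \<psi> ` cdom A W"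
    "\<And>x. x \<in> \<psi> ` W \<Longrightarrow> inv_into (cdom A W) (cmap A W \<psi>) (S W \<psi> x) = ?s (inv_into W \<psi> x)"
    if "(W, \<psi>) \<in> A" for W \<psi>
    using section_chart[OF that \<sigma>(1)] unfolding S_def by blast+
  have comp_smooth: "f \<circ> ?s \<in> smooth_funs A" if f: "f \<in> smooth_funs CB" for f
    unfolding smooth_funs_def
  proof clarify
    fix W \<psi> assume W: "(W, \<psi>) \<in> A"
    note CW = cot_chart_in[OF W]
    have "smooth_on (\<psi> ` W) ((f \<circ> inv_into (cdom A W) (cmap A W \<psi>)) \<circ> S W \<psi>)"
      by (rule smooth_on_compose[OF chart_open[OF W] B.chart_open[OF CW] _ S(1)[OF W] smooth_funs_chart[OF f CW]])
        (use S(2)[OF W] in auto)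
    then show "smooth_on (\<psi> ` W) (f \<circ> ?s \<circ> inv_into W \<psi>)"
      by (rule smooth_on_cong[OF chart_open[OF W], rotated]) (simp add: S(3)[OF W])
  qed
  let ?E = "frechet_derivative (S U \<phi>) (at (\<phi> (fst z)))"
  have "pushforward CB ?s v f = cvec U \<phi> z (?E u) f" for f
  proof (cases "f \<in> smooth_funs CB")
    case f: True
    let ?F = "f \<circ> inv_into (cdom A U) (cmap A U \<phi>)"
    have Sz: "S U \<phi> (\<phi> (fst z)) = cmap A U \<phi> z"
      using U m \<sigma>(2) by (simp add: S_def)
    have "(?F \<circ> S U \<phi> has_derivative frechet_derivative ?F (at (cmap A U \<phi> z)) \<circ> ?E) (at (\<phi> (fst z)))"
      by (rule diff_chain_at[OF smooth_on_has_derivative[OF S(1)[OF U(1)] imageI[OF m]]])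
        (use B.smooth_fun_has_derivative[OF f C U(2)] Sz in simp)
    then have "((f \<circ> ?s) \<circ> inv_into U \<phi> has_derivative
        frechet_derivative ?F (at (cmap A U \<phi> z)) \<circ> ?E) (at (\<phi> (fst z)))"
      by (rule has_derivative_transform_within_open[OF _ chart_open[OF U(1)] imageI[OF m]])
        (simp add: S(3)[OF U(1)])
    from frechet_derivative_at[OF this, THEN fun_cong, of u] show ?thesis
      using f comp_smooth[OF f] by (simp add: u pushforward_def coord_vec_apply B.coord_vec_apply)
  qed (simp add: pushforward_def coord_vec_def)
  then have "pushforward CB ?s v = cvec U \<phi> z (?E u)" by blast
  then show "pushforward CB ?s v \<in> tangent_space CB z"
    using B.coord_vec_tangent[OF C U(2)] by simp
  show "pushforward A fst (pushforward CB ?s v) = v"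
  proof
    fix f
    show "pushforward A fst (pushforward CB ?s v) f = v f"
      using pullback_smooth[of f] tangent_nonsmooth[OF v, of f] by (auto simp: pushforward_def o_def)
  qed
  show "pushforward CB ?s v (lin_fun Y) = v (\<lambda>p. \<sigma> p (Y p))" if Y: "Y \<in> vfields A"
    using lin_fun_smooth[OF Y] by (simp add: pushforward_def lin_fun_def o_def)
qed

text \<open>
  For the vector \<open>\<sigma>\<^sub>* X\<^sub>m - (\<nabla>\<^sub>X \<sigma>)\<^sub>m\<close> the action on \<open>Y\<^sup>v\<close> is
  \<open>X(\<sigma>(Y)) - (\<nabla>\<^sub>X \<sigma>)(Y) = \<sigma>(\<nabla>\<^sub>X Y)\<close> at \<open>m\<close>, that is \<open>\<zeta>(\<nabla>\<^sub>X Y)\<close>. The section \<open>\<sigma>\<close> has dropped out, and only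
  the value of \<open>X\<close> at \<open>m\<close> matters since \<open>\<nabla>\<^sub>X Y\<close> is tensorial in \<open>X\<close>.
\<close>

lemma horizontal_vec:
  assumes z: "z \<in> points CB" and X: "X \<in> vfields A"
    and w: "w \<in> horizontal_space A nab z" "pushforward A fst w = X (fst z)"
  shows "w \<in> tangent_space CB z"
    and "Y \<in> vfields A \<Longrightarrow> w (lin_fun Y) = snd z (nab X Y (fst z))"
proof -
  obtain X' \<sigma> where w': "w = (\<lambda>f. pushforward CB (\<lambda>p. (p, \<sigma> p)) (X' (fst z)) f
      - vertical_vec A z (nabla_form A nab X' \<sigma> (fst z)) f)"
    and X': "X' \<in> vfields A" and \<sigma>: "\<sigma> \<in> forms1 A" "\<sigma> (fst z) = snd z"
    using w(1) unfolding horizontal_space_def by blast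
  note m = cot_pointsD[OF z]
  note Xm = vfields_tangent[OF X' m(1)]
  note sec = section_pushforward[OF z \<sigma> Xm]
  note N = nabla_form[OF nab X' \<sigma>(1)]
  note ver = vertical_vec[OF z forms1_cotangent[OF N(1) m(1)]]
  show "w \<in> tangent_space CB z"
    using B.tangent_lin[OF sec(1) ver(1), of 1 "- 1"] by (simp add: w')
  have "pushforward A fst w = X' (fst z)"
    unfolding w' by (rule pr_diff_vertical[OF sec(2) ver(2)])
  then have eq: "X (fst z) = X' (fst z)" using w(2) by simp
  show "w (lin_fun Y) = snd z (nab X Y (fst z))" if Y: "Y \<in> vfields A"
    using sec(3)[OF Y] ver(3)[OF Y] N(2)[OF Y m(1)] \<sigma>(2) connection_pointwise[OF nab X X' Y m(1) eq]
    by (simp add: w')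
qed

lemma horizontal_vec_exists:
  assumes z: "z \<in> points CB" and X: "X \<in> vfields A"
  obtains w where "w \<in> horizontal_space A nab z" "pushforward A fst w = X (fst z)"
proof -
  note m = cot_pointsD[OF z]
  obtain \<sigma> where \<sigma>: "\<sigma> \<in> forms1 A" "\<sigma> (fst z) = snd z" using m by (rule covector_extend)
  let ?w = "\<lambda>f. pushforward CB (\<lambda>p. (p, \<sigma> p)) (X (fst z)) f
      - vertical_vec A z (nabla_form A nab X \<sigma> (fst z)) f"
  have "?w \<in> horizontal_space A nab z"
    unfolding horizontal_space_def using X \<sigma> by blast
  moreover have "pushforward A fst ?w = X (fst z)"
    by (rule pr_diff_vertical[OF section_pushforward(2)[OF z \<sigma> vfields_tangent[OF X m(1)]]
          vertical_vec(2)[OF z forms1_cotangent[OF nabla_form(1)[OF nab X \<sigma>(1)] m(1)]]])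
  ultimately show ?thesis by (rule that)
qed

text \<open>
  The identity \<open>X\<^sup>h Y\<^sup>v = (\<nabla>\<^sub>X Y)\<^sup>v\<close>. By \<open>horizontal_vec\<close>, the projection of a horizontal vector
  determines its action on all \<open>Y\<^sup>v\<close>, so \<open>cot_tangent_eqI\<close> gives the uniqueness that the definition of
  the lift requires.
\<close>

lemma hlift:
  assumes z: "z \<in> points CB" and X: "X \<in> vfields A"
  shows "hlift A nab X z \<in> tangent_space CB z"
    and "pushforward A fst (hlift A nab X z) = X (fst z)"
    and "Y \<in> vfields A \<Longrightarrow> hlift A nab X z (lin_fun Y) = snd z (nab X Y (fst z))"
proof -
  let ?P = "\<lambda>w. w \<in> horizontal_space A nab z \<and> pushforward A fst w = X (fst z)"
  obtain w where w: "w \<in> horizontal_space A nab z" "pushforward A fst w = X (fst z)"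
    using z X by (rule horizontal_vec_exists)
  have uniq: "w' = w" if "?P w'" for w'
  proof (rule cot_tangent_eqI)
    show "w' \<in> tangent_space CB z" "w \<in> tangent_space CB z"
      using horizontal_vec(1)[OF z X w]
        horizontal_vec(1)[OF z X conjunct1[OF that] conjunct2[OF that]] by simp_all
    show "pushforward A fst w' = pushforward A fst w" using that w by simp
    show "w' (lin_fun Y) = w (lin_fun Y)" if "Y \<in> vfields A" for Y
      using horizontal_vec(2)[OF z X w that]
        horizontal_vec(2)[OF z X conjunct1[OF \<open>?P w'\<close>] conjunct2[OF \<open>?P w'\<close>] that] by simp
  qed
  have "(THE w. ?P w) = w" by (rule the_equality[of ?P, OF conjI[OF w]]) (rule uniq)
  then have "hlift A nab X z = w" using z by (simp add: hlift_def)
  then show "hlift A nab X z \<in> tangent_space CB z"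
    "pushforward A fst (hlift A nab X z) = X (fst z)"
    "Y \<in> vfields A \<Longrightarrow> hlift A nab X z (lin_fun Y) = snd z (nab X Y (fst z))"
    using horizontal_vec[OF z X w] w(2) by simp_all
qed

lemma hlift_vfields:
  assumes X: "X \<in> vfields A"
  shows "hlift A nab X \<in> vfields CB"
proof (rule cot_vfieldsI)
  show "(\<lambda>z. hlift A nab X z (f \<circ> fst)) \<in> smooth_funs CB" if f: "f \<in> smooth_funs A" for f
    by (rule B.smooth_funs_cong[OF pullback_smooth[OF vfields_smooth[OF X f]]])
      (simp add: pr_eq_apply[OF hlift(2)[OF _ X] f])
  show "(\<lambda>z. hlift A nab X z (lin_fun Y)) \<in> smooth_funs CB" if Y: "Y \<in> vfields A" for Y
    by (rule B.smooth_funs_cong[OF lin_fun_smooth[OF connectionD(1)[OF nab X Y]]])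
      (simp add: hlift(3)[OF _ X Y] lin_fun_def)
qed (erule hlift(1)[OF _ X], simp add: hlift_def)

section \<open>The symmetric derivative of the canonical form\<close>

text \<open>
  Subtracting the horizontal lift of an extension of the projection leaves a vertical vector.
\<close>

lemma tangent_decomposition:
  assumes w: "w \<in> tangent_space CB z"
  obtains X \<alpha> where "X \<in> vfields A" "\<alpha> \<in> forms1 A" "w = vf_add (hlift A nab X) (vlift A \<alpha>) z"
proof -
  have z: "z \<in> points CB" by (rule B.tangent_point[OF w])
  then obtain U \<phi> where U: "(U, \<phi>) \<in> A" "z \<in> cdom A U" by (rule cot_pointsE)
  note m = fst_cdom(1)[OF U(2)]
  obtain X where X: "X \<in> vfields A" "X (fst z) = pushforward A fst w"
    using pr_tangent[OF w] by (rule vector_extend)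
  let ?v = "\<lambda>f. 1 * w f + (- 1) * hlift A nab X z f"
  have v: "?v \<in> tangent_space CB z" by (rule B.tangent_lin[OF w hlift(1)[OF z X(1)]])
  obtain u p where up: "?v = cvec U \<phi> z (u, p)" using v U by (rule cotangent_tangentE)
  have "coord_vec A (U, \<phi>) (fst z) u = (\<lambda>f. 1 * pushforward A fst w f
      + (- 1) * pushforward A fst (hlift A nab X z) f)"
    unfolding pr_cvec[OF U, symmetric, of u p] up[symmetric] by (rule pr_lin)
  then have "coord_vec A (U, \<phi>) (fst z) u = coord_vec A (U, \<phi>) (fst z) 0"
    using hlift(2)[OF z X(1)] X(2) cvec_zero[OF U(1) m] by simp
  then have u0: "u = 0" by (rule coord_vec_inj[OF U(1) m])
  let ?\<eta> = "covec A (U, \<phi>) (fst z) p"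
  have \<eta>: "?\<eta> \<in> cotangent_space A (fst z)" by (rule covec_cotangent[OF U(1) m])
  then obtain \<alpha> where \<alpha>: "\<alpha> \<in> forms1 A" "\<alpha> (fst z) = ?\<eta>"
    using covector_extend[OF cot_pointsD(1)[OF z]] by blast
  have "vlift A \<alpha> z = cvec U \<phi> z (u, p)"
    using z \<alpha>(2) vertical_vec_cvec[OF U \<eta>] U(1) m
    by (simp add: vlift_def u0 euclidean_representation)
  then have "w = vf_add (hlift A nab X) (vlift A \<alpha>) z"
    unfolding up[symmetric] by (simp add: vf_add_def)
  with X(1) \<alpha>(1) show ?thesis by (rule that)
qed

lemma canonical_form_lifts:
  assumes z: "z \<in> points CB"
  shows "X \<in> vfields A \<Longrightarrow> canonical_form A z (hlift A nab X z) = snd z (X (fst z))"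
    and "\<alpha> \<in> forms1 A \<Longrightarrow> canonical_form A z (vlift A \<alpha> z) = 0"
  using hlift(1,2)[OF z] vlift(1,2)[OF _ z] canonical_form_apply cotangent_zero cot_pointsD[OF z]
  by simp_all

lemma canonical_form_lift_sum:
  assumes z: "z \<in> points CB" and X: "X \<in> vfields A" and \<alpha>: "\<alpha> \<in> forms1 A"
  shows "canonical_form A z (vf_add (hlift A nab X) (vlift A \<alpha>) z) = lin_fun X z"
  using B.form_add[OF canonical_form_forms1 hlift_vfields[OF X] vlift_vfields[OF \<alpha>] z]
    canonical_form_lifts[OF z] X \<alpha> by (simp add: lin_fun_def)

text \<open>
  Both \<open>P(Y\<^sup>v)\<close> and the value of the canonical form on the derivative of \<open>Q = Y\<^sup>h + \<beta>\<^sup>v\<close> along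
  \<open>P = X\<^sup>h + \<alpha>\<^sup>v\<close> contain \<open>(\<nabla>\<^sub>X Y)\<^sup>v\<close>. It cancels in their difference, leaving \<open>\<alpha>(Y)\<close>.
\<close>

lemma lifted_derivative_canonical_form:
  assumes D: "lifted_connection A nab D" and z: "z \<in> points CB"
    and X: "X \<in> vfields A" and Y: "Y \<in> vfields A" and \<alpha>: "\<alpha> \<in> forms1 A" and \<beta>: "\<beta> \<in> forms1 A"
  shows "nabla_form CB D (vf_add (hlift A nab X) (vlift A \<alpha>)) (canonical_form A) z
      (vf_add (hlift A nab Y) (vlift A \<beta>) z) = \<alpha> (fst z) (Y (fst z))"
proof -
  let ?P = "vf_add (hlift A nab X) (vlift A \<alpha>)" and ?Q = "vf_add (hlift A nab Y) (vlift A \<beta>)"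
  note H = hlift_vfields and V = vlift_vfields
  have con: "connection CB D" using D by (simp add: lifted_connection_def)
  note c = B.connectionD[OF con]
  have P: "?P \<in> vfields CB" and Q: "?Q \<in> vfields CB"
    using B.vf_add_vfields H V X Y \<alpha> \<beta> by auto
  have nb: "nabla_form A nab X \<beta> \<in> forms1 A" by (rule nabla_form(1)[OF nab X \<beta>])
  have nY: "nab X Y \<in> vfields A" by (rule connectionD(1)[OF nab X Y])
  have "D ?P ?Q = vf_add (vf_add (D (hlift A nab X) (hlift A nab Y)) (D (vlift A \<alpha>) (hlift A nab Y)))
      (vf_add (D (hlift A nab X) (vlift A \<beta>)) (D (vlift A \<alpha>) (vlift A \<beta>)))"
    using c(3)[OF P H[OF Y] V[OF \<beta>]] c(2)[OF H[OF X] V[OF \<alpha>] H[OF Y]]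
      c(2)[OF H[OF X] V[OF \<alpha>] V[OF \<beta>]] by simp
  also have "\<dots> = vf_add (hlift A nab (nab X Y)) (vlift A (nabla_form A nab X \<beta>))"
    using D X Y \<alpha> \<beta> by (simp add: lifted_connection_def) (simp add: vf_add_def vf_zero_def)
  finally have can: "canonical_form A z (D ?P ?Q z) = snd z (nab X Y (fst z))"
    using canonical_form_lift_sum[OF z nY nb] by (simp add: lin_fun_def)
  have "?P z (\<lambda>p. canonical_form A p (?Q p)) = ?P z (lin_fun Y)"
    by (rule B.tangent_derivation(4)[OF B.vfields_tangent[OF P z] B.forms1_smooth[OF canonical_form_forms1 Q]])
      (rule canonical_form_lift_sum[OF _ Y \<beta>])
  also have "\<dots> = snd z (nab X Y (fst z)) + \<alpha> (fst z) (Y (fst z))"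
    using hlift(3)[OF z X Y] vlift(3)[OF \<alpha> z Y] by (simp add: vf_add_def)
  finally show ?thesis
    using B.nabla_form(2)[OF con P canonical_form_forms1 Q z] can by simp
qed

lemma sym_deriv_canonical_form:
  assumes D: "lifted_connection A nab D" and g: "patterson_walker A nab g"
    and Q: "Q \<in> vfields CB" "Q' \<in> vfields CB" and z: "z \<in> points CB"
  shows "sym_deriv CB D (canonical_form A) Q Q' z = g z (Q z) (Q' z)"
proof -
  obtain X \<alpha> where X: "X \<in> vfields A" "\<alpha> \<in> forms1 A" "Q z = vf_add (hlift A nab X) (vlift A \<alpha>) z"
    using B.vfields_tangent[OF Q(1) z] by (rule tangent_decomposition)
  obtain Y \<beta> where Y: "Y \<in> vfields A" "\<beta> \<in> forms1 A" "Q' z = vf_add (hlift A nab Y) (vlift A \<beta>) z"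
    using B.vfields_tangent[OF Q(2) z] by (rule tangent_decomposition)
  have con: "connection CB D" using D by (simp add: lifted_connection_def)
  note pw = B.nabla_form_pointwise[OF con _ B.vf_add_vfields[OF hlift_vfields vlift_vfields]
      canonical_form_forms1 _ z]
  have "nabla_form CB D Q (canonical_form A) z (Q' z) = \<alpha> (fst z) (Y (fst z))"
    using pw[OF Q(1) X(1,2) Q(2) X(3)] lifted_derivative_canonical_form[OF D z X(1) Y(1) X(2) Y(2)] Y(3)
    by simp
  moreover have "nabla_form CB D Q' (canonical_form A) z (Q z) = \<beta> (fst z) (X (fst z))"
    using pw[OF Q(2) Y(1,2) Q(1) Y(3)] lifted_derivative_canonical_form[OF D z Y(1) X(1) Y(2) X(2)] X(3)
    by simp
  moreover have "g z (Q z) (Q' z) = \<alpha> (fst z) (Y (fst z)) + \<beta> (fst z) (X (fst z))"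
    using g X Y z unfolding patterson_walker_def by metis
  ultimately show ?thesis by (simp add: sym_deriv_def)
qed

end

theorem theorem5p7:
  fixes A :: "('a, 'e::euclidean_space) atlas"
    and nab :: "'a vfield \<Rightarrow> 'a vfield \<Rightarrow> 'a vfield"
    and D :: "'a cpoint vfield \<Rightarrow> 'a cpoint vfield \<Rightarrow> 'a cpoint vfield"
    and g :: "'a cpoint \<Rightarrow> 'a cpoint tvec \<Rightarrow> 'a cpoint tvec \<Rightarrow> real"
  assumes "smooth_manifold A"
    and "connection A nab"
    and "lifted_connection A nab D"
    and "patterson_walker A nab g"
  shows "\<forall>Q\<in>vfields (cotangent_bundle A). \<forall>Q'\<in>vfields (cotangent_bundle A).
           \<forall>z\<in>points (cotangent_bundle A).
             sym_deriv (cotangent_bundle A) D (canonical_form A) Q Q' z = g z (Q z) (Q' z)"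
proof -
  interpret bump_atlas A by (rule smooth_manifold_bump_atlas[OF assms(1)])
  interpret cotangent_connection A nab by unfold_locales (rule assms(2))
  show ?thesis using sym_deriv_canonical_form[OF assms(3,4)] by blast
qed

end
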